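(* Let $z_1$ be the solution of the initial value problem $z_1''(t)+\frac{n-1}{2}\bigl(\ln(E G)\bigr)'(t)\,z_1'(t)+(2n-1)z_1(t)=0$, $z_1(0)=1$, $z_1'(0)=0$. Then the first nonzero eigenvalue of $-\Delta$ on the Carlotto–Schulz hypersurface $X$ equals $2n-1$ if and only if $z_1'(T)>0$.
   Context: Fix an integer $n>1$. Let $(r,\theta,\alpha)$ be the Carlotto–Schulz solution on $\mathbb{R}$ of the system $r'=\cos\alpha$, $\theta'=\sin\alpha/\sin r$, $\alpha'=(2n-2)\csc r\,\cos\alpha\,\cot(2\theta)-(2n-1)\cot r\,\sin\alpha$, normalized so that for some $T>0$, $r_0\in(0,\pi/2)$, $\theta_0\in(0,\pi/4)$: $r(0)=\pi/2$, $\alpha(0)=0$, $\theta(0)=\theta_0$, and $\theta(-T/4)=\pi/4$, $r(-T/4)=r_0$, $\alpha(-T/4)=-\pi/2$. Standing facts about this solution: $r,\theta$ are $T$-periodic and $\alpha(t+T)=\alpha(t)+2\pi$; for all $t$: $\theta(-t)=\theta(t)$, $\theta(T/2-t)=\pi/2-\theta(t)$, $r(-t)=\pi-r(t)$, $r(T/2-t)=r(t)$, $\alpha(-t)=-\alpha(t)$, $\alpha(T/2-t)=\pi-\alpha(t)$; $\theta$ is strictly increasing on $[0,T/2]$ with minimum $\theta_0$, $r$ is strictly increasing on $[-T/4,T/4]$ with minimum $r_0$, $\alpha$ is strictly increasing; $0<\theta<\pi/2$ and $0<r<\pi$. The Carlotto–Schulz hypersurface is the minimal embedding $X:\mathbb{S}^{n-1}\times\mathbb{S}^{n-1}\times(\mathbb{R}/T\mathbb{Z})\to\mathbb{S}^{2n}\subset\mathbb{R}^{2n+1}$,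 $X(y,z,t)=(\sin r\cos\theta\,y,\ \sin r\sin\theta\,z,\ \cos r)$, with induced metric $dt^2+E(t)g_{\mathbb{S}^{n-1}}+G(t)g_{\mathbb{S}^{n-1}}$, where $E=\sin^2 r\cos^2\theta$, $G=\sin^2 r\sin^2\theta$; $\Delta$ denotes its Laplace–Beltrami operator. *)

theory Defs
  imports "HOL-Analysis.Analysis"
begin

fun Ck_on :: "nat \<Rightarrow> 'a::euclidean_space set \<Rightarrow> ('a \<Rightarrow> real) \<Rightarrow> bool" where
  "Ck_on 0 U f = continuous_on U f"
| "Ck_on (Suc k) U f =
     ((\<forall>x\<in>U. f differentiable (at x)) \<and>
      (\<forall>b\<in>Basis. Ck_on k U (\<lambda>x. frechet_derivative f (at x) b)))"

definition smooth_on :: "'a::euclidean_space set \<Rightarrow> ('a \<Rightarrow> real) \<Rightarrow> bool" where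
  "smooth_on U f \<longleftrightarrow> (\<forall>k. Ck_on k U f)"

definition CS_E :: "(real \<Rightarrow> real) \<Rightarrow> (real \<Rightarrow> real) \<Rightarrow> real \<Rightarrow> real" where
  "CS_E r \<theta> t = (sin (r t))\<^sup>2 * (cos (\<theta> t))\<^sup>2"

definition CS_G :: "(real \<Rightarrow> real) \<Rightarrow> (real \<Rightarrow> real) \<Rightarrow> real \<Rightarrow> real" where
  "CS_G r \<theta> t = (sin (r t))\<^sup>2 * (sin (\<theta> t))\<^sup>2"

text \<open>Laplacian of the round unit sphere S^{n-1} in R^n: Euclidean Laplacian of the
  0-homogeneous extension u(x/|x|), evaluated at a point y of the sphere.\<close>
definition sphere_lap :: "(real^'n \<Rightarrow> real) \<Rightarrow> real^'n \<Rightarrow> real" where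
  "sphere_lap u y =
     (\<Sum>i\<in>UNIV. deriv (deriv (\<lambda>s. u ((1 / norm (y + s *\<^sub>R axis i 1)) *\<^sub>R (y + s *\<^sub>R axis i 1)))) 0)"

text \<open>Manifold S^{n-1} x S^{n-1} x R (the t-factor taken mod T via periodicity).\<close>
definition CS_M :: "((real^'n) \<times> (real^'n) \<times> real) set" where
  "CS_M = {(y, z, t). norm y = 1 \<and> norm z = 1}"

text \<open>Laplace--Beltrami operator of the metric dt^2 + E g_S + G g_S
  (n = CARD('n)), applied to F(y,z,t).\<close>
definition CS_lap :: "(real \<Rightarrow> real) \<Rightarrow> (real \<Rightarrow> real) \<Rightarrow>
    ((real^'n) \<times> (real^'n) \<times> real \<Rightarrow> real) \<Rightarrow> (real^'n) \<times> (real^'n) \<times> real \<Rightarrow> real" where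
  "CS_lap r \<theta> F p = (case p of (y, z, t) \<Rightarrow>
      deriv (deriv (\<lambda>s. F (y, z, s))) t
    + (real CARD('n) - 1) / 2 * deriv (\<lambda>s. ln (CS_E r \<theta> s * CS_G r \<theta> s)) t
        * deriv (\<lambda>s. F (y, z, s)) t
    + sphere_lap (\<lambda>w. F (w, z, t)) y / CS_E r \<theta> t
    + sphere_lap (\<lambda>w. F (y, w, t)) z / CS_G r \<theta> t)"

definition CS_eigenvalue :: "(real \<Rightarrow> real) \<Rightarrow> (real \<Rightarrow> real) \<Rightarrow> real \<Rightarrow> 'n::finite itself \<Rightarrow> real \<Rightarrow> bool" where
  "CS_eigenvalue r \<theta> T (_ :: 'n itself) mu \<longleftrightarrow>
     (\<exists>(F :: (real^'n) \<times> (real^'n) \<times> real \<Rightarrow> real) U.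
        open U \<and> CS_M \<subseteq> U \<and> smooth_on U F \<and>
        (\<forall>y z t. (y, z, t) \<in> CS_M \<longrightarrow> F (y, z, t + T) = F (y, z, t)) \<and>
        (\<exists>p\<in>CS_M. F p \<noteq> 0) \<and>
        (\<forall>p\<in>CS_M. - CS_lap r \<theta> F p = mu * F p))"

definition first_nonzero_eigenvalue :: "(real \<Rightarrow> real) \<Rightarrow> (real \<Rightarrow> real) \<Rightarrow> real \<Rightarrow> 'n::finite itself \<Rightarrow> real" where
  "first_nonzero_eigenvalue r \<theta> T N = Inf {mu. mu \<noteq> 0 \<and> CS_eigenvalue r \<theta> T N mu}"

end

(*
  With x = sin r cos theta, y = sin r sin theta and L f = f'' + (n-1)/2 (ln (E G))' f',
  minimality says L(cos r) = -(2n-1) cos r, L x = -(2n-1) x + (n-1)/x and the same for y.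
  It turns out that both sides of the equivalence always hold.

  First eigenvalue.  Let F be an eigenfunction with eigenvalue mu < 2n-1.  For a reflection rho of
  the first sphere in the hyperplane orthogonal to e, the difference F - F o rho vanishes for y.e = 0,
  while on y.e > 0 the positive coordinate eigenfunction x(t) (y.e) belongs to the larger eigenvalue
  2n-1; the maximum principle (after making the comparison function positive up to the boundary)
  gives F <= F o rho.  Hence F is rotationally invariant in both sphere factors and is a T-periodic
  function f(t) with L f = -mu f.  Sturm comparison with -cos r on [0,T/2] kills the odd part
  of f, comparison with x - y on [-T/4,T/4] kills the part antisymmetric about T/4, and for the rest,
  which has a zero inside [0,T/4] because mu <> 0, both comparisons together finish.

  Sign of z_1'(T).  The function x - y satisfies L(x - y) + (2n-1)(x - y) = -(n-1)(x - y)/(x y) < 0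
  on (-T/4,T/4) and vanishes at the ends, so Sturm comparison gives z_1(T/4) > 0.
  The symmetries of the equation turn this into z_1'(T) > 0.
*)
theory Submission
  imports Defs
begin

section \<open>The spherical Laplacian\<close>

text \<open>Separating variables would need a spectral theorem on the product; reflections and a
  pointwise maximum principle use only second derivatives at a single point. The obstacle is the
  equator of the hemisphere: both F - F o rho and x(t) (y.e) vanish there, so their quotient need
  not attain a maximum. A small second harmonic added to y.e makes the denominator positive, and the
  gap 2n-1-mu leaves room for it. \<open>sphere_lap\<close> is written with coordinate axes and a
  normalised extension, which hides its invariance under reflections; a closed form in gradient and
  Hessian reveals it. The infimum ranges over all nonzero mu, negative ones included. The
  comparisons ask only for mu < 2n-1, so negative values need no treatment of their own. The two
  comparison functions complement each other: -cos r has zeros at 0 and T/2 and a critical point at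
  T/4, while x - y has zeros at T/4 and -T/4 and a critical point at 0.\<close>

lemma deriv_deriv_eq:
  fixes f :: "real \<Rightarrow> real"
  assumes "\<forall>\<^sub>F s in nhds t. (f has_real_derivative f' s) (at s)"
    and "(f' has_real_derivative D) (at t)"
  shows "deriv (deriv f) t = D"
proof -
  have "\<forall>\<^sub>F s in nhds t. deriv f s = f' s"
    using assms(1) by eventually_elim (rule DERIV_imp_deriv)
  then have "deriv (deriv f) t = deriv f' t"
    by (rule deriv_cong_ev) simp
  then show ?thesis using assms(2) DERIV_imp_deriv by metis
qed

text \<open>If \<open>D\<close> were negative, \<open>f'\<close> would be negative just to the right
  of \<open>t\<close> and \<open>f\<close> would drop below \<open>f t\<close>. No continuity of a
  second derivative enters, which is why \<open>C2_on\<close> can do without it.\<close>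

lemma second_derivative_local_min:
  fixes f :: "real \<Rightarrow> real"
  assumes d1: "\<forall>\<^sub>F s in nhds t. (f has_real_derivative f' s) (at s)"
    and d2: "(f' has_real_derivative D) (at t)"
    and min: "\<forall>\<^sub>F s in nhds t. f t \<le> f s"
  shows "f' t = 0" "0 \<le> D"
proof -
  have "\<forall>\<^sub>F s in nhds t. (f has_real_derivative f' s) (at s) \<and> f t \<le> f s"
    using d1 min by eventually_elim simp
  then obtain e where e: "e > 0"
    "\<And>s. dist s t < e \<Longrightarrow> (f has_real_derivative f' s) (at s) \<and> f t \<le> f s"
    unfolding eventually_nhds_metric by blast
  have e': "\<And>s. \<bar>s - t\<bar> < e \<Longrightarrow> (f has_real_derivative f' s) (at s) \<and> f t \<le> f s"
    using e(2) by (simp add: dist_real_def)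
  show z: "f' t = 0"
    by (rule DERIV_local_min[of f "f' t" t e]) (use e' e(1) in \<open>auto simp: abs_minus_commute\<close>)
  show "0 \<le> D"
  proof (rule ccontr)
    assume "\<not> 0 \<le> D"
    then obtain d where d: "d > 0" "\<And>h. 0 < h \<Longrightarrow> h < d \<Longrightarrow> f' (t + h) < f' t"
      using DERIV_neg_dec_right[OF d2] by (auto simp: not_le)
    define h where "h = min d e / 2"
    have h: "0 < h" "h < d" "h < e" using d e by (auto simp: h_def min_def)
    have "f (t + h) < f t"
    proof (rule DERIV_neg_imp_decreasing_open[of t "t + h" f])
      show "t < t + h" using h by simp
      show "\<exists>y. DERIV f s :> y \<and> y < 0" if "t < s" "s < t + h" for s
        using that h d(2)[of "s - t"] e'[of s] z by (intro exI[of _ "f' s"]) auto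
      show "continuous_on {t..t + h} f"
        using e' h by (intro continuous_at_imp_continuous_on ballI DERIV_isCont[where D="f' _"]) force
    qed
    then show False using e'[of "t + h"] h by simp
  qed
qed

text \<open>\<open>HF p d c\<close> is the derivative at \<open>p\<close> in direction \<open>c\<close> of \<open>q \<mapsto> DF q d\<close>.\<close>
definition C2_on :: "'a::real_normed_vector set \<Rightarrow> ('a \<Rightarrow> real) \<Rightarrow> ('a \<Rightarrow> 'a \<Rightarrow> real)
    \<Rightarrow> ('a \<Rightarrow> 'a \<Rightarrow> 'a \<Rightarrow> real) \<Rightarrow> bool" where
  "C2_on U F DF HF \<longleftrightarrow> open U \<and> (\<forall>p\<in>U. (F has_derivative DF p) (at p) \<and>
      (\<forall>d. ((\<lambda>q. DF q d) has_derivative HF p d) (at p)))"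

lemma C2_onD:
  assumes "C2_on U F DF HF"
  shows "open U" "\<And>p. p \<in> U \<Longrightarrow> (F has_derivative DF p) (at p)"
    "\<And>p d. p \<in> U \<Longrightarrow> ((\<lambda>q. DF q d) has_derivative HF p d) (at p)"
  using assms unfolding C2_on_def by auto

lemma C2_on_linear1:
  assumes "C2_on U F DF HF" "p \<in> U"
  shows "linear (DF p)" "linear (HF p d)"
  using C2_onD[OF assms(1)] assms(2) has_derivative_linear by blast+

text \<open>\<open>C2_on\<close> yields linearity of \<open>HF p d\<close> only in its last
  argument. Linearity in \<open>d\<close> is inherited from that of \<open>DF q\<close> near
  \<open>p\<close>, by uniqueness of derivatives.\<close>

lemma C2_on_linear2:
  assumes C: "C2_on U F DF HF" and p: "p \<in> U"
  shows "HF p (a + b) c = HF p a c + HF p b c" "HF p (k *\<^sub>R a) c = k * HF p a c"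
proof -
  note [simp] = linear_add[OF C2_on_linear1(1)[OF C]] linear_scale[OF C2_on_linear1(1)[OF C]]
  have "((\<lambda>q. DF q (a + b)) has_derivative (\<lambda>c. HF p a c + HF p b c)) (at p)"
    by (rule has_derivative_transform_within_open[where f="\<lambda>q. DF q a + DF q b", OF _ C2_onD(1)[OF C] p])
       (use C2_onD(3)[OF C p] in \<open>auto intro!: derivative_intros\<close>)
  with C2_onD(3)[OF C p] have "HF p (a + b) = (\<lambda>c. HF p a c + HF p b c)"
    by (rule has_derivative_unique)
  then show "HF p (a + b) c = HF p a c + HF p b c" by simp
  have "((\<lambda>q. DF q (k *\<^sub>R a)) has_derivative (\<lambda>c. k * HF p a c)) (at p)"
    by (rule has_derivative_transform_within_open[where f="\<lambda>q. k * DF q a", OF _ C2_onD(1)[OF C] p])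
       (use C2_onD(3)[OF C p] in \<open>auto intro!: derivative_intros\<close>)
  with C2_onD(3)[OF C p] have "HF p (k *\<^sub>R a) = (\<lambda>c. k * HF p a c)"
    by (rule has_derivative_unique)
  then show "HF p (k *\<^sub>R a) c = k * HF p a c" by simp
qed

lemma C2_on_bilinear:
  assumes C: "C2_on U F DF HF" and p: "p \<in> U"
  shows "linear (\<lambda>d. HF p d c)" "linear (HF p d)"
  using C2_on_linear2[OF assms] C2_on_linear1(2)[OF assms] by (auto intro: linearI)

lemma smooth_on_imp_C2_on:
  fixes F :: "'a::euclidean_space \<Rightarrow> real"
  assumes "smooth_on U F" "open U"
  shows "\<exists>DF HF. C2_on U F DF HF"
proof -
  define DF where "DF = (\<lambda>p. frechet_derivative F (at p))"
  have "Ck_on (Suc (Suc 0)) U F" using assms(1) unfolding smooth_on_def by blast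
  then have 1: "\<And>p. p \<in> U \<Longrightarrow> F differentiable (at p)"
    and 2: "\<And>p b. p \<in> U \<Longrightarrow> b \<in> Basis \<Longrightarrow> (\<lambda>q. DF q b) differentiable (at p)"
    unfolding DF_def by auto
  have D: "(F has_derivative DF p) (at p)" if "p \<in> U" for p
    using 1[OF that] unfolding DF_def by (simp add: frechet_derivative_works)
  have "(\<lambda>q. DF q d) differentiable (at p)" if p: "p \<in> U" for p d
  proof -
    \<comment> \<open>\<open>Ck_on\<close> speaks of basis directions only, so an arbitrary
      direction \<open>d\<close> is expanded in the basis.\<close>
    have "((\<lambda>q. \<Sum>b\<in>Basis. (d \<bullet> b) * DF q b) has_derivative
        (\<lambda>h. \<Sum>b\<in>Basis. (d \<bullet> b) * frechet_derivative (\<lambda>q. DF q b) (at p) h)) (at p)"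
      by (intro derivative_intros) (use 2[OF p] frechet_derivative_works in blast)
    moreover have "(\<Sum>b\<in>Basis. (d \<bullet> b) * DF q b) = DF q d" if "q \<in> U" for q
    proof -
      have "DF q d = DF q (\<Sum>b\<in>Basis. (d \<bullet> b) *\<^sub>R b)" by (simp add: euclidean_representation)
      also have "\<dots> = (\<Sum>b\<in>Basis. (d \<bullet> b) * DF q b)"
        using has_derivative_linear[OF D[OF that]] by (simp add: linear_sum linear_scale)
      finally show ?thesis by simp
    qed
    ultimately have "((\<lambda>q. DF q d) has_derivative
        (\<lambda>h. \<Sum>b\<in>Basis. (d \<bullet> b) * frechet_derivative (\<lambda>q. DF q b) (at p) h)) (at p)"
      by (rule has_derivative_transform_within_open[OF _ assms(2) p])
    then show ?thesis unfolding differentiable_def by blast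
  qed
  then have "C2_on U F DF (\<lambda>p d. frechet_derivative (\<lambda>q. DF q d) (at p))"
    unfolding C2_on_def using D assms(2) by (simp add: frechet_derivative_works)
  then show ?thesis by blast
qed

text \<open>Expresses the Laplacian of the \<open>0\<close>-homogeneous extension of \<open>u\<close> at a unit vector \<open>y\<close> through the
  gradient \<open>D\<close> and Hessian \<open>H\<close> of \<open>u\<close> itself; in this form orthogonal invariance is bilinear algebra.\<close>
definition sphere_lap_form :: "(real^'n \<Rightarrow> real) \<Rightarrow> (real^'n \<Rightarrow> real^'n \<Rightarrow> real) \<Rightarrow> real^'n \<Rightarrow> real" where
  "sphere_lap_form D H y = (\<Sum>i\<in>UNIV. H (axis i 1) (axis i 1)) - H y y - (real CARD('n) - 1) * D y"

text \<open>\<open>c\<close> is the line through \<open>y\<close> in direction \<open>d\<close>,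
  projected radially to the sphere; for \<open>d\<close> a coordinate axis it is the curve inside
  \<open>sphere_lap\<close>. The second derivative keeps \<open>Hu y d y\<close> and
  \<open>Hu y y d\<close> apart, since \<open>Hu\<close> is not assumed symmetric.\<close>

lemma radial_curve_derivatives:
  fixes u :: "real^'n \<Rightarrow> real"
  assumes C: "C2_on S u Du Hu" and yS: "y \<in> S" and y: "norm y = 1" and d: "norm d = 1"
  defines "c \<equiv> \<lambda>s. (1 / norm (y + s *\<^sub>R d)) *\<^sub>R (y + s *\<^sub>R d)"
  defines "k \<equiv> y \<bullet> d"
  obtains g where "\<forall>\<^sub>F s in nhds 0. ((\<lambda>s. u (c s)) has_real_derivative g s) (at s)"
    "(g has_real_derivative Hu y d d - k * Hu y d y - k * Hu y y d + k\<^sup>2 * Hu y y y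
        - 2 * k * Du y d - (1 - 3 * k\<^sup>2) * Du y y) (at 0)"
    "c 0 = y" "(c \<longlongrightarrow> y) (nhds 0)" "\<forall>\<^sub>F s in nhds 0. norm (c s) = 1"
proof -
  define N where "N = (\<lambda>s. norm (y + s *\<^sub>R d))"
  define A where "A = (\<lambda>s. 1 / N s)"
  \<comment> \<open>\<open>B\<close> is minus the derivative of \<open>A\<close>, because
    \<open>N' = (k + s) / N\<close>; hence \<open>c' = (A - s * B) d - B y\<close>.\<close>
  define B where "B = (\<lambda>s. (k + s) / N s ^ 3)"
  have dd: "d \<bullet> d = 1" using d by (simp add: norm_eq_1)
  have N0: "N 0 = 1" using y by (simp add: N_def)
  have ne: "y + s *\<^sub>R d \<noteq> 0" if "\<bar>s\<bar> < 1" for s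
  proof
    assume "y + s *\<^sub>R d = 0"
    then have "norm y = norm (s *\<^sub>R d)" by (metis add_eq_0_iff norm_minus_cancel)
    then show False using y d that by simp
  qed
  have Npos: "N s > 0" if "\<bar>s\<bar> < 1" for s using ne[OF that] by (simp add: N_def)
  have N': "(N has_real_derivative (k + s) / N s) (at s)" if "\<bar>s\<bar> < 1" for s
  proof -
    have "(N has_derivative (\<lambda>h. (h *\<^sub>R d) \<bullet> sgn (y + s *\<^sub>R d))) (at s)"
      unfolding N_def using ne[OF that]
      by (intro has_derivative_compose[where g=norm, OF _ has_derivative_norm])
        (auto intro!: derivative_eq_intros)
    moreover have "(h *\<^sub>R d) \<bullet> sgn (y + s *\<^sub>R d) = (k + s) / N s * h" for h
      using dd by (simp add: sgn_div_norm N_def k_def inner_add_right inner_commute divide_inverse algebra_simps)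
    ultimately have "(N has_derivative (\<lambda>h. (k + s) / N s * h)) (at s)" by (simp only:)
    then show ?thesis by (simp only: has_field_derivative_def)
  qed
  have A': "(A has_real_derivative - (k + s) / N s ^ 3) (at s)" if "\<bar>s\<bar> < 1" for s
    unfolding A_def using Npos[OF that]
    by (auto intro!: derivative_eq_intros N'[OF that] simp: power2_eq_square power3_eq_cube field_simps)
  have B': "(B has_real_derivative (1 - 3 * k\<^sup>2)) (at 0)"
    unfolding B_def using N0
    by (auto intro!: derivative_eq_intros N'[of 0] simp: power2_eq_square field_simps)
  have ceq: "c s = A s *\<^sub>R (y + s *\<^sub>R d)" for s by (simp add: c_def A_def N_def)
  have c': "(c has_vector_derivative (A s - s * B s) *\<^sub>R d - B s *\<^sub>R y) (at s)" if "\<bar>s\<bar> < 1" for s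
  proof -
    have "(c has_vector_derivative A s *\<^sub>R d + (- (k + s) / N s ^ 3) *\<^sub>R (y + s *\<^sub>R d)) (at s)"
      unfolding ceq[abs_def]
      by (rule has_vector_derivative_scaleR[OF A'[OF that]])
         (auto intro!: derivative_eq_intros simp: has_vector_derivative_def)
    moreover have "- (k + s) / N s ^ 3 = - B s" by (simp add: B_def minus_divide_left)
    moreover have "A s *\<^sub>R d + (- B s) *\<^sub>R (y + s *\<^sub>R d) = (A s - s * B s) *\<^sub>R d - B s *\<^sub>R y"
      by (simp add: algebra_simps)
    ultimately show ?thesis by (simp only:)
  qed
  have c0: "c 0 = y" using N0 by (simp add: ceq A_def)
  have "continuous (at 0) c"
    using c'[of 0] has_vector_derivative_continuous by auto
  then have cl: "(c \<longlongrightarrow> y) (nhds 0)"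
    using c0 tendsto_at_iff_tendsto_nhds[of c 0] by (simp add: continuous_at)
  have near1: "\<forall>\<^sub>F s::real in nhds 0. \<bar>s\<bar> < 1"
    using eventually_nhds_in_open[of "{-1<..<1}" "0::real"] by (auto elim: eventually_mono)
  have nearS: "\<forall>\<^sub>F s in nhds 0. c s \<in> S"
    using topological_tendstoD[OF cl C2_onD(1)[OF C] yS] .
  define g where "g = (\<lambda>s. (A s - s * B s) * Du (c s) d - B s * Du (c s) y)"
  show thesis
  proof (rule that[of g])
    show "\<forall>\<^sub>F s in nhds 0. ((\<lambda>s. u (c s)) has_real_derivative g s) (at s)"
      using near1 nearS
    proof eventually_elim
      case (elim s)
      note lin = C2_on_linear1(1)[OF C elim(2)]
      have "((\<lambda>s. u (c s)) has_derivative (\<lambda>h. Du (c s) (h *\<^sub>R ((A s - s * B s) *\<^sub>R d - B s *\<^sub>R y)))) (at s)"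
        by (rule has_derivative_compose[OF c'[OF elim(1), unfolded has_vector_derivative_def] C2_onD(2)[OF C elim(2)]])
      moreover have "Du (c s) (h *\<^sub>R ((A s - s * B s) *\<^sub>R d - B s *\<^sub>R y)) = g s * h" for h
        unfolding g_def linear_scale[OF lin] linear_diff[OF lin] by simp
      ultimately show ?case by (simp only: has_field_derivative_def)
    qed
    have L: "((\<lambda>s. Du (c s) e) has_real_derivative Hu y e d - k * Hu y e y) (at 0)" for e
    proof -
      note lin = C2_on_linear1(2)[OF C yS, of e]
      have "((\<lambda>q. Du q e) has_derivative Hu y e) (at (c 0))" using C2_onD(3)[OF C yS] c0 by simp
      from has_derivative_compose[OF c'[of 0, unfolded has_vector_derivative_def] this]
      have "((\<lambda>s. Du (c s) e) has_derivative (\<lambda>h. Hu y e (h *\<^sub>R (d - k *\<^sub>R y)))) (at 0)"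
        using N0 by (simp add: A_def B_def)
      moreover have "Hu y e (h *\<^sub>R (d - k *\<^sub>R y)) = (Hu y e d - k * Hu y e y) * h" for h
        unfolding linear_scale[OF lin] linear_diff[OF lin] by simp
      ultimately show ?thesis by (simp only: has_field_derivative_def)
    qed
    show "(g has_real_derivative Hu y d d - k * Hu y d y - k * Hu y y d + k\<^sup>2 * Hu y y y
        - 2 * k * Du y d - (1 - 3 * k\<^sup>2) * Du y y) (at 0)"
      unfolding g_def
      by (auto intro!: derivative_eq_intros A'[of 0] B' L)
         (auto simp: N0 c0 A_def B_def power2_eq_square algebra_simps)
    show "\<forall>\<^sub>F s in nhds 0. norm (c s) = 1"
      using near1 by eventually_elim (use ne in \<open>auto simp: c_def\<close>)
  qed (fact c0 cl)+
qed

text \<open>In the sum over the axes, the terms weighted by \<open>y $ i\<close> recombine by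
  linearity into derivatives in direction \<open>y\<close>, and the squares sum to 1. The radial
  curves stay on the sphere, so at a minimum among unit vectors each summand is nonnegative, and so
  is the sum.\<close>

lemma
  fixes u :: "real^'n \<Rightarrow> real"
  assumes C: "C2_on S u Du Hu" and yS: "y \<in> S" and y: "norm y = 1"
  shows sphere_lap_eq_form: "sphere_lap u y = sphere_lap_form (Du y) (Hu y) y"
    and sphere_lap_form_local_min:
      "(\<forall>\<^sub>F y' in nhds y. norm y' = 1 \<longrightarrow> u y \<le> u y') \<Longrightarrow> 0 \<le> sphere_lap_form (Du y) (Hu y) y"
proof -
  define c where "c = (\<lambda>d s. (1 / norm (y + s *\<^sub>R d)) *\<^sub>R (y + s *\<^sub>R d))"
  define D2 where "D2 = (\<lambda>d. Hu y d d - (y \<bullet> d) * Hu y d y - (y \<bullet> d) * Hu y y d + (y \<bullet> d)\<^sup>2 * Hu y y y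
        - 2 * (y \<bullet> d) * Du y d - (1 - 3 * (y \<bullet> d)\<^sup>2) * Du y y)"
  have D2: "deriv (deriv (\<lambda>s. u (c d s))) 0 = D2 d"
    and D2_nonneg: "(\<forall>\<^sub>F y' in nhds y. norm y' = 1 \<longrightarrow> u y \<le> u y') \<Longrightarrow> 0 \<le> D2 d"
    if d: "norm d = 1" for d
  proof -
    obtain g where g: "\<forall>\<^sub>F s in nhds 0. ((\<lambda>s. u (c d s)) has_real_derivative g s) (at s)"
      "(g has_real_derivative D2 d) (at 0)"
      "c d 0 = y" "(c d \<longlongrightarrow> y) (nhds 0)" "\<forall>\<^sub>F s in nhds 0. norm (c d s) = 1"
      using radial_curve_derivatives[OF C yS y d] unfolding c_def D2_def by blast
    show "deriv (deriv (\<lambda>s. u (c d s))) 0 = D2 d" using g by (intro deriv_deriv_eq)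
    assume "\<forall>\<^sub>F y' in nhds y. norm y' = 1 \<longrightarrow> u y \<le> u y'"
    then have "\<forall>\<^sub>F s in nhds 0. norm (c d s) = 1 \<longrightarrow> u y \<le> u (c d s)"
      using g(4) by (rule eventually_compose_filterlim)
    with g(5) have "\<forall>\<^sub>F s in nhds 0. u (c d 0) \<le> u (c d s)"
      unfolding g(3) by eventually_elim simp
    then show "0 \<le> D2 d" using second_derivative_local_min(2) g by blast
  qed
  have axis: "y \<bullet> axis i 1 = y $ i" for i by (simp add: inner_axis)
  have rep: "(\<Sum>i\<in>UNIV. y $ i *\<^sub>R axis i 1) = y"
    using basis_expansion[of y] by (simp add: scalar_mult_eq_scaleR)
  have lin_rep: "(\<Sum>i\<in>UNIV. y $ i * f (axis i 1)) = f y" if "linear f" for f :: "real^'n \<Rightarrow> real"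
    by (subst rep[symmetric], subst linear_sum[OF that]) (simp add: linear_scale[OF that])
  have sq: "(\<Sum>i\<in>UNIV. (y $ i)\<^sup>2) = 1"
    using y norm_eq_1[of y] by (simp add: inner_vec_def power2_eq_square)
  note bil = C2_on_bilinear[OF C yS] C2_on_linear1[OF C yS]
  have "(\<Sum>i\<in>UNIV. D2 (axis i 1)) = (\<Sum>i\<in>UNIV. Hu y (axis i 1) (axis i 1))
      - (\<Sum>i\<in>UNIV. y $ i * Hu y (axis i 1) y) - (\<Sum>i\<in>UNIV. y $ i * Hu y y (axis i 1))
      + (\<Sum>i\<in>UNIV. (y $ i)\<^sup>2) * Hu y y y - 2 * (\<Sum>i\<in>UNIV. y $ i * Du y (axis i 1))
      - (real CARD('n) - 3 * (\<Sum>i\<in>UNIV. (y $ i)\<^sup>2)) * Du y y"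
    unfolding D2_def axis
    by (simp add: sum.distrib sum_subtractf sum_distrib_left sum_distrib_right algebra_simps)
  also have "\<dots> = sphere_lap_form (Du y) (Hu y) y"
    unfolding sq lin_rep[OF bil(1)] lin_rep[OF bil(2)] lin_rep[OF bil(3)] sphere_lap_form_def
    by (simp add: algebra_simps)
  finally have sum: "(\<Sum>i\<in>UNIV. D2 (axis i 1)) = sphere_lap_form (Du y) (Hu y) y" .
  show "sphere_lap u y = sphere_lap_form (Du y) (Hu y) y"
    unfolding sphere_lap_def sum[symmetric] using D2 by (auto simp: c_def norm_axis_1 intro!: sum.cong)
  show "0 \<le> sphere_lap_form (Du y) (Hu y) y" if "\<forall>\<^sub>F y' in nhds y. norm y' = 1 \<longrightarrow> u y \<le> u y'"
    unfolding sum[symmetric] using D2_nonneg[OF _ that] by (auto intro!: sum_nonneg)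
qed

section \<open>Hyperplane reflections and zonal functions\<close>

definition hyperplane_reflection :: "real^'n \<Rightarrow> real^'n \<Rightarrow> real^'n" where
  "hyperplane_reflection e y = y - (2 * (y \<bullet> e)) *\<^sub>R e"

lemma linear_hyperplane_reflection: "linear (hyperplane_reflection e)"
  by (auto intro!: linearI simp: hyperplane_reflection_def inner_add_left algebra_simps)

lemma hyperplane_reflection_props:
  assumes "norm e = 1"
  shows "norm (hyperplane_reflection e y) = norm y"
    and "y \<bullet> e = 0 \<Longrightarrow> hyperplane_reflection e y = y"
proof -
  have "e \<bullet> e = 1" using assms by (simp add: norm_eq_1)
  then have "(hyperplane_reflection e y) \<bullet> (hyperplane_reflection e y) = y \<bullet> y"
    by (simp add: hyperplane_reflection_def inner_diff_left inner_diff_right inner_commute)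
  then show "norm (hyperplane_reflection e y) = norm y" by (simp add: norm_eq_sqrt_inner)
qed (simp add: hyperplane_reflection_def)

text \<open>The left side is the Laplacian at \<open>y\<close> of a function composed with the
  reflection. In the trace the correction terms are -2, -2 and +4 times \<open>H e e\<close> and
  cancel; the remaining terms agree at once.\<close>

lemma sphere_lap_form_reflection:
  assumes e: "norm e = 1" and H1: "\<And>c. linear (\<lambda>d. H d c)" and H2: "\<And>d. linear (H d)"
  defines "\<rho> \<equiv> hyperplane_reflection e"
  shows "sphere_lap_form (\<lambda>d. D (\<rho> d)) (\<lambda>d c. H (\<rho> d) (\<rho> c)) y
    = sphere_lap_form D H (\<rho> y)"
proof -
  have rep: "(\<Sum>i\<in>UNIV. e $ i *\<^sub>R axis i 1) = e"
    using basis_expansion[of e] by (simp add: scalar_mult_eq_scaleR)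
  have lin_rep: "(\<Sum>i\<in>UNIV. e $ i * f (axis i 1)) = f e" if "linear f" for f :: "real^'a \<Rightarrow> real"
    by (subst rep[symmetric], subst linear_sum[OF that]) (simp add: linear_scale[OF that])
  have sq: "(\<Sum>i\<in>UNIV. (e $ i)\<^sup>2) = 1"
    using e norm_eq_1[of e] by (simp add: inner_vec_def power2_eq_square)
  have H: "H (\<rho> d) (\<rho> c) = H d c - 2 * (d \<bullet> e) * H e c - 2 * (c \<bullet> e) * H d e
      + 4 * (d \<bullet> e) * (c \<bullet> e) * H e e" for d c
    by (simp add: \<rho>_def hyperplane_reflection_def linear_diff[OF H1] linear_diff[OF H2]
        linear_scale[OF H1] linear_scale[OF H2] algebra_simps)
  have "(\<Sum>i\<in>UNIV. H (\<rho> (axis i 1)) (\<rho> (axis i 1))) = (\<Sum>i\<in>UNIV. H (axis i 1) (axis i 1))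
      - 2 * (\<Sum>i\<in>UNIV. e $ i * H e (axis i 1)) - 2 * (\<Sum>i\<in>UNIV. e $ i * H (axis i 1) e)
      + 4 * (\<Sum>i\<in>UNIV. (e $ i)\<^sup>2) * H e e"
    unfolding sum_distrib_left sum_distrib_right sum_subtractf[symmetric] sum.distrib[symmetric]
    by (rule sum.cong[OF refl]) (simp add: H inner_axis' power2_eq_square)
  also have "\<dots> = (\<Sum>i\<in>UNIV. H (axis i 1) (axis i 1))"
    unfolding lin_rep[OF H1] lin_rep[OF H2] sq by simp
  finally show ?thesis unfolding sphere_lap_form_def by simp
qed

text \<open>The arguments are the ambient gradient and Hessian of w -> g(w.e); the result is the
  Legendre-type operator of zonal functions.\<close>

lemma sphere_lap_form_zonal:
  assumes e: "norm e = 1" and y: "norm (y::real^'n) = 1"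
  shows "sphere_lap_form (\<lambda>d. g' * (d \<bullet> e)) (\<lambda>d c. g'' * (d \<bullet> e) * (c \<bullet> e)) y
    = g'' * (1 - (y \<bullet> e)\<^sup>2) - (real CARD('n) - 1) * g' * (y \<bullet> e)"
proof -
  have "(\<Sum>i\<in>UNIV. (e $ i)\<^sup>2) = 1"
    using e norm_eq_1[of e] by (simp add: inner_vec_def power2_eq_square)
  then have "(\<Sum>i\<in>UNIV. g'' * (e $ i) * (e $ i)) = g''"
    by (simp add: mult.assoc sum_distrib_left[symmetric] power2_eq_square)
  then show ?thesis unfolding sphere_lap_form_def
    by (simp add: inner_axis' power2_eq_square algebra_simps)
qed

lemma sphere_lap_form_linear_comb:
  "sphere_lap_form (\<lambda>d. D1 d + k * D2 d) (\<lambda>d c. H1 d c + k * H2 d c) y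
    = sphere_lap_form D1 H1 y + k * sphere_lap_form D2 H2 y"
  by (simp add: sphere_lap_form_def sum.distrib sum_distrib_left[symmetric] algebra_simps)

section \<open>Twice differentiable functions on the product and the warped Laplacian\<close>

lemma C2_on_compose_affine:
  assumes C: "C2_on U F DF HF" and L: "bounded_linear L"
  shows "C2_on {w. a + L w \<in> U} (\<lambda>w. F (a + L w)) (\<lambda>w d. DF (a + L w) (L d))
           (\<lambda>w d c. HF (a + L w) (L d) (L c))"
proof -
  have aff: "((\<lambda>w. a + L w) has_derivative L) (at w)" for w
    using bounded_linear_imp_has_derivative[OF L] by (auto intro!: derivative_eq_intros)
  have "continuous_on UNIV (\<lambda>w. a + L w)"
    by (intro continuous_intros linear_continuous_on L)
  then have "open ((\<lambda>w. a + L w) -` U)"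
    using C2_onD(1)[OF C] by (intro open_vimage) auto
  then have "open {w. a + L w \<in> U}" by (simp add: vimage_def)
  then show ?thesis
    unfolding C2_on_def
    using has_derivative_compose[OF aff C2_onD(2)[OF C]] has_derivative_compose[OF aff C2_onD(3)[OF C]]
    by auto
qed

lemma C2_on_linear_comb:
  assumes "C2_on U F DF HF" "C2_on V F' DF' HF'"
  shows "C2_on (U \<inter> V) (\<lambda>p. F p + k * F' p) (\<lambda>p d. DF p d + k * DF' p d) (\<lambda>p d c. HF p d c + k * HF' p d c)"
  unfolding C2_on_def
proof (intro conjI ballI allI)
  show "open (U \<inter> V)" using assms C2_onD(1) by blast
next
  fix p d assume p: "p \<in> U \<inter> V"
  show "((\<lambda>p. F p + k * F' p) has_derivative (\<lambda>d. DF p d + k * DF' p d)) (at p)"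
    by (intro has_derivative_add has_derivative_mult_right) (use p assms C2_onD(2) in blast)+
  show "((\<lambda>q. DF q d + k * DF' q d) has_derivative (\<lambda>c. HF p d c + k * HF' p d c)) (at p)"
    by (intro has_derivative_add has_derivative_mult_right) (use p assms C2_onD(3) in blast)+
qed

text \<open>This is \<open>CS_lap\<close> expressed through gradient and Hessian, with
  \<open>p\<close> in place of the logarithmic derivative. Keeping \<open>E\<close> and
  \<open>G\<close> as parameters lets one lemma serve both spheres, with \<open>E\<close> and
  \<open>G\<close> exchanged.\<close>

definition warped_lap :: "(real \<Rightarrow> real) \<Rightarrow> (real \<Rightarrow> real) \<Rightarrow> (real \<Rightarrow> real)
    \<Rightarrow> ((real^'n) \<times> (real^'n) \<times> real \<Rightarrow> (real^'n) \<times> (real^'n) \<times> real \<Rightarrow> real)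
    \<Rightarrow> ((real^'n) \<times> (real^'n) \<times> real \<Rightarrow> (real^'n) \<times> (real^'n) \<times> real \<Rightarrow> (real^'n) \<times> (real^'n) \<times> real \<Rightarrow> real)
    \<Rightarrow> real^'n \<Rightarrow> real^'n \<Rightarrow> real \<Rightarrow> real" where
  "warped_lap p E G DF HF y z t =
     HF (y, z, t) (0, 0, 1) (0, 0, 1) + p t * DF (y, z, t) (0, 0, 1)
   + sphere_lap_form (\<lambda>d. DF (y, z, t) (d, 0, 0)) (\<lambda>d c. HF (y, z, t) (d, 0, 0) (c, 0, 0)) y / E t
   + sphere_lap_form (\<lambda>d. DF (y, z, t) (0, d, 0)) (\<lambda>d c. HF (y, z, t) (0, d, 0) (0, c, 0)) z / G t"

lemma C2_on_slices:
  fixes F :: "(real^'n) \<times> (real^'n) \<times> real \<Rightarrow> real"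
  assumes C: "C2_on U F DF HF"
  shows "C2_on {w. (w, z, t) \<in> U} (\<lambda>w. F (w, z, t)) (\<lambda>w d. DF (w, z, t) (d, 0, 0)) (\<lambda>w d c. HF (w, z, t) (d, 0, 0) (c, 0, 0))"
    "C2_on {w. (y, w, t) \<in> U} (\<lambda>w. F (y, w, t)) (\<lambda>w d. DF (y, w, t) (0, d, 0)) (\<lambda>w d c. HF (y, w, t) (0, d, 0) (0, c, 0))"
    "C2_on {s. (y, z, s) \<in> U} (\<lambda>s. F (y, z, s)) (\<lambda>s d. DF (y, z, s) (0, 0, d)) (\<lambda>s d c. HF (y, z, s) (0, 0, d) (0, 0, c))"
proof -
  have "bounded_linear (\<lambda>w::real^'n. (w, 0::real^'n, 0::real))" "bounded_linear (\<lambda>w::real^'n. (0::real^'n, w, 0::real))"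
    "bounded_linear (\<lambda>s::real. (0::real^'n, 0::real^'n, s))"
    by (intro bounded_linear_Pair bounded_linear_ident bounded_linear_zero)+
  from C2_on_compose_affine[OF C this(1), of "(0, z, t)"] C2_on_compose_affine[OF C this(2), of "(y, 0, t)"]
    C2_on_compose_affine[OF C this(3), of "(y, z, 0)"]
  show "C2_on {w. (w, z, t) \<in> U} (\<lambda>w. F (w, z, t)) (\<lambda>w d. DF (w, z, t) (d, 0, 0)) (\<lambda>w d c. HF (w, z, t) (d, 0, 0) (c, 0, 0))"
    "C2_on {w. (y, w, t) \<in> U} (\<lambda>w. F (y, w, t)) (\<lambda>w d. DF (y, w, t) (0, d, 0)) (\<lambda>w d c. HF (y, w, t) (0, d, 0) (0, c, 0))"
    "C2_on {s. (y, z, s) \<in> U} (\<lambda>s. F (y, z, s)) (\<lambda>s d. DF (y, z, s) (0, 0, d)) (\<lambda>s d c. HF (y, z, s) (0, 0, d) (0, 0, c))"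
    by simp_all
qed

lemma C2_on_real:
  fixes f :: "real \<Rightarrow> real"
  assumes C: "C2_on S f Df Hf" and t: "t \<in> S"
  shows "(f has_real_derivative Df t 1) (at t)" "((\<lambda>s. Df s 1) has_real_derivative Hf t 1 1) (at t)"
    "\<forall>\<^sub>F s in nhds t. (f has_real_derivative Df s 1) (at s)"
proof -
  have *: "(f has_real_derivative Df t 1) (at t)" if "t \<in> S" for t
  proof -
    have "Df t h = Df t 1 * h" for h
      using linear_scale[OF C2_on_linear1(1)[OF C that], of h 1] by simp
    then have "Df t = (*) (Df t 1)" by (rule ext)
    then show ?thesis using C2_onD(2)[OF C that] unfolding has_field_derivative_def by (simp only:)
  qed
  then show "(f has_real_derivative Df t 1) (at t)" using t .
  have "Hf t 1 h = Hf t 1 1 * h" for h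
    using linear_scale[OF C2_on_linear1(2)[OF C t], of 1 h 1] by simp
  then have "Hf t 1 = (*) (Hf t 1 1)" by (rule ext)
  then show "((\<lambda>s. Df s 1) has_real_derivative Hf t 1 1) (at t)"
    using C2_onD(3)[OF C t, of 1] unfolding has_field_derivative_def by (simp only:)
  show "\<forall>\<^sub>F s in nhds t. (f has_real_derivative Df s 1) (at s)"
    using eventually_nhds_in_open[OF C2_onD(1)[OF C] t] by eventually_elim (rule *)
qed

lemma periodic_int:
  fixes f :: "real \<Rightarrow> 'a"
  assumes "\<And>t. f (t + T) = f t"
  shows "f (t + of_int k * T) = f t"
proof -
  have nat: "f (t + real m * T) = f t" for m t
  proof (induction m)
    case (Suc m)
    have "f (t + real (Suc m) * T) = f (t + real m * T + T)" by (simp add: algebra_simps)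
    then show ?case using assms Suc by simp
  qed simp
  show ?thesis
  proof (cases "k \<ge> 0")
    case True then show ?thesis using nat[of t "nat k"] by simp
  next
    case False then show ?thesis using nat[of "t + of_int k * T" "nat (- k)"] by simp
  qed
qed

lemma periodic_shift:
  fixes T t :: real
  assumes "T > 0"
  obtains k :: int where "t + of_int k * T \<in> {0..T}"
proof
  have "of_int \<lfloor>t / T\<rfloor> * T \<le> t" "t \<le> (of_int \<lfloor>t / T\<rfloor> + 1) * T"
    unfolding pos_le_divide_eq[OF assms, symmetric] pos_divide_le_eq[OF assms, symmetric] by linarith+
  then show "t + of_int (- \<lfloor>t / T\<rfloor>) * T \<in> {0..T}" by (simp add: algebra_simps)
qed

section \<open>Rotational invariance of eigenfunctions\<close>

text \<open>The zonal function \<open>s\<close> is a first spherical harmonic and \<open>1 - N s\<^sup>2\<close> a second one. Adding a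
  small multiple of the latter makes \<open>s\<close> positive at the equator; the resulting strict inequality is
  paid for by the spectral gap \<open>\<eta>\<close>.\<close>
lemma zonal_supersolution:
  fixes N \<eta> :: real
  assumes "N \<ge> 1" "\<eta> > 0"
  defines "\<epsilon> \<equiv> \<eta> / (N * (N + 1 + \<eta>))"
  assumes s: "0 \<le> s" "s \<le> 1"
  shows "0 < s + \<epsilon> * (1 - N * s\<^sup>2)"
    and "- (2 * N * \<epsilon>) * (1 - s\<^sup>2) - (N - 1) * (1 - 2 * N * \<epsilon> * s) * s
      + (N - 1 - \<eta>) * (s + \<epsilon> * (1 - N * s\<^sup>2)) < 0"
proof -
  have e: "\<epsilon> > 0" using assms by (simp add: \<epsilon>_def)
  have "N * (N + 1 + \<eta>) \<noteq> 0" using assms by simp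
  \<comment> \<open>This equation dictates the choice of \<epsilon>: the left side of the second
    claim collapses to -\<epsilon> (N + 1 + \<eta>) - \<eta> (s - s^2), which is negative because
    s^2 \<le> s.\<close>
  then have eN: "\<epsilon> * N * (N + 1 + \<eta>) = \<eta>" unfolding \<epsilon>_def mult.assoc by simp
  have s2: "s\<^sup>2 \<le> s" using s by (simp add: power2_eq_square mult_left_le)
  have "\<epsilon> * N * 1 \<le> \<epsilon> * N * (N + 1 + \<eta>) / (N + 1 + \<eta>)" using assms by simp
  also have "\<dots> < 1" unfolding eN using assms by simp
  finally have "(\<epsilon> * N) * s\<^sup>2 \<le> 1 * s" using s2 s e assms by (intro mult_mono) auto
  then show "0 < s + \<epsilon> * (1 - N * s\<^sup>2)" using e by (simp add: algebra_simps)
  have "\<eta> * s\<^sup>2 \<le> \<eta> * s" using s2 assms by simp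
  then have "\<epsilon> * N * (N + 1 + \<eta>) * s\<^sup>2 \<le> \<eta> * s" unfolding eN .
  moreover have "\<epsilon> * (N + 1 + \<eta>) > 0" using e assms by simp
  ultimately show "- (2 * N * \<epsilon>) * (1 - s\<^sup>2) - (N - 1) * (1 - 2 * N * \<epsilon> * s) * s
      + (N - 1 - \<eta>) * (s + \<epsilon> * (1 - N * s\<^sup>2)) < 0"
    by (simp add: algebra_simps power2_eq_square)
qed

lemma C2_on_zonal:
  "C2_on UNIV (\<lambda>w::real^'n. (w \<bullet> e) + \<epsilon> * (1 - N * (w \<bullet> e)\<^sup>2))
     (\<lambda>w d. (1 - 2 * N * \<epsilon> * (w \<bullet> e)) * (d \<bullet> e)) (\<lambda>w d c. - (2 * N * \<epsilon>) * (d \<bullet> e) * (c \<bullet> e))"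
  unfolding C2_on_def
proof (intro conjI ballI allI)
  fix p d :: "real^'n"
  have inner: "((\<lambda>w. w \<bullet> e) has_derivative (\<lambda>d. d \<bullet> e)) (at p)"
    by (rule bounded_linear_imp_has_derivative[OF bounded_linear_inner_left])
  have "((\<lambda>s. s + \<epsilon> * (1 - N * s\<^sup>2)) has_real_derivative 1 - 2 * N * \<epsilon> * (p \<bullet> e)) (at (p \<bullet> e))"
    by (auto intro!: derivative_eq_intros)
  from has_derivative_compose[OF inner this[unfolded has_field_derivative_def]]
  show "((\<lambda>w. (w \<bullet> e) + \<epsilon> * (1 - N * (w \<bullet> e)\<^sup>2)) has_derivative (\<lambda>d. (1 - 2 * N * \<epsilon> * (p \<bullet> e)) * (d \<bullet> e))) (at p)" .
  have "((\<lambda>s. (1 - 2 * N * \<epsilon> * s) * (d \<bullet> e)) has_real_derivative - (2 * N * \<epsilon>) * (d \<bullet> e)) (at (p \<bullet> e))"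
    by (auto intro!: derivative_eq_intros)
  from has_derivative_compose[OF inner this[unfolded has_field_derivative_def]]
  show "((\<lambda>w. (1 - 2 * N * \<epsilon> * (w \<bullet> e)) * (d \<bullet> e)) has_derivative (\<lambda>c. - (2 * N * \<epsilon>) * (d \<bullet> e) * (c \<bullet> e))) (at p)" .
qed simp

text \<open>Vectors of equal norm are mirror images in the perpendicular bisector of the segment
  between them, which then passes through the origin.\<close>

lemma reflection_swapping:
  fixes a b :: "real^'n"
  assumes "norm a = norm b" "a \<noteq> b"
  defines "e \<equiv> (1 / norm (a - b)) *\<^sub>R (a - b)"
  shows "norm e = 1" "0 < a \<bullet> e" "hyperplane_reflection e a = b"
proof -
  define N where "N = norm (a - b)"
  have N: "N > 0" using assms by (simp add: N_def)
  have "a \<bullet> a = b \<bullet> b" using assms by (metis norm_eq)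
  then have "2 * (a \<bullet> (a - b)) = (a - b) \<bullet> (a - b)" by (simp add: inner_diff_left inner_diff_right inner_commute)
  then have *: "2 * (a \<bullet> (a - b)) = N\<^sup>2" by (simp add: N_def power2_norm_eq_inner)
  show "norm e = 1" using N by (simp add: e_def N_def)
  have "a \<bullet> e = (a \<bullet> (a - b)) / N" unfolding e_def inner_scaleR_right N_def[symmetric] by simp
  then have ae: "2 * (a \<bullet> e) = N" using * N by (simp add: power2_eq_square)
  then show "0 < a \<bullet> e" using N by simp
  have "hyperplane_reflection e a = a - N *\<^sub>R e" unfolding hyperplane_reflection_def ae ..
  then show "hyperplane_reflection e a = b" using N by (simp add: e_def N_def[symmetric])
qed

text \<open>The assumptions on \<open>x\<close> say that x(t) (y.e) is an eigenfunction for
  \<open>lam\<close>: the extra term (n-1) x / E compensates the first spherical harmonic.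
  Exchanging \<open>y1\<close> and \<open>y2\<close> turns the inequality into rotational
  invariance.\<close>

lemma warped_lap_rotation_invariant_le:
  fixes F :: "(real^'n) \<times> (real^'n) \<times> real \<Rightarrow> real" and x x' E G p :: "real \<Rightarrow> real"
  assumes C: "C2_on U F DF HF" and M: "CS_M \<subseteq> U" and T: "T > 0"
    and F_per: "\<And>y z t. norm y = 1 \<Longrightarrow> norm z = 1 \<Longrightarrow> F (y, z, t + T) = F (y, z, t)"
    and E_per: "\<And>t. E (t + T) = E t" and x_per: "\<And>t. x (t + T) = x t"
    and pos: "\<And>t. E t > 0" "\<And>t. G t > 0" "\<And>t. x t > 0"
    and contE: "continuous_on UNIV E"
    and x1: "\<And>t. (x has_real_derivative x' t) (at t)"
    and x2: "\<And>t. (x' has_real_derivative - p t * x' t - lam * x t + (real CARD('n) - 1) * x t / E t) (at t)"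
    and eig: "\<And>y z t. norm y = 1 \<Longrightarrow> norm z = 1 \<Longrightarrow> warped_lap p E G DF HF y z t = - mu * F (y, z, t)"
    and mu: "mu < lam"
    and y1: "norm y1 = 1" and y2: "norm y2 = 1" and z1: "norm z1 = 1"
  shows "F (y1, z1, t1) \<le> F (y2, z1, t1)"
proof (rule ccontr)
  assume neg: "\<not> F (y1, z1, t1) \<le> F (y2, z1, t1)"
  define N where "N = real CARD('n)"
  have N: "N \<ge> 1" by (simp add: N_def Suc_leI)
  define e where "e = (1 / norm (y1 - y2)) *\<^sub>R (y1 - y2)"
  define \<rho> where "\<rho> = hyperplane_reflection e"
  have e: "norm e = 1" "0 < y1 \<bullet> e" "\<rho> y1 = y2"
    using reflection_swapping[of y1 y2] y1 y2 neg unfolding e_def \<rho>_def by auto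
  note \<rho> = hyperplane_reflection_props[OF e(1), folded \<rho>_def]
  have inU: "(a, b, s) \<in> U" if "norm a = 1" "norm b = 1" for a b s using M that by (auto simp: CS_M_def)
  have ae1: "a \<bullet> e \<le> 1" if "norm a = 1" for a using norm_cauchy_schwarz[of a e] e(1) that by simp

  \<comment> \<open>The zonal inequality has one gap \<eta> for all times, so (lam - mu) E(t) needs
    a positive lower bound; periodicity reduces this to a compact interval.\<close>
  have "\<exists>t0\<in>{0..T}. \<forall>t\<in>{0..T}. E t0 \<le> E t"
    using T continuous_on_subset[OF contE] by (intro continuous_attains_inf) auto
  then obtain t0 where t0: "\<And>t. t \<in> {0..T} \<Longrightarrow> E t0 \<le> E t" by blast
  have Emin: "E t0 \<le> E t" for t
  proof -
    obtain k :: int where "t + of_int k * T \<in> {0..T}" using periodic_shift[OF T] .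
    then show ?thesis using t0 periodic_int[of E T t k, OF E_per] by metis
  qed
  define \<eta> where "\<eta> = (lam - mu) * E t0"
  have eta: "\<eta> > 0" using mu pos(1) by (simp add: \<eta>_def)
  define \<epsilon> where "\<epsilon> = \<eta> / (N * (N + 1 + \<eta>))"
  define g where "g s = s + \<epsilon> * (1 - N * s\<^sup>2)" for s :: real
  note g = zonal_supersolution[OF N eta, folded \<epsilon>_def, folded g_def]

  have upos: "x t * g (w \<bullet> e) > 0" if "norm w = 1" "0 \<le> w \<bullet> e" for w t
    using pos(3) g(1) ae1 that by simp
  define v where "v = (\<lambda>(a, b, s). F (a, b, s) - F (\<rho> a, b, s))"
  \<comment> \<open>The denominator is positive on the whole closed hemisphere, equator included, so
    \<open>q\<close> attains its maximum over one period.\<close>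
  define q where "q = (\<lambda>(a, b, s). v (a, b, s) / (x s * g (a \<bullet> e)))"
  define K where "K = (sphere 0 1 \<inter> {a. 0 \<le> a \<bullet> e}) \<times> sphere (0::real^'n) 1 \<times> {0..T}"
  have "closed {a. 0 \<le> a \<bullet> e}" by (intro closed_Collect_le continuous_intros)
  then have "compact K" unfolding K_def by (intro compact_Times compact_Int_closed) auto
  moreover obtain k1 :: int where k1: "t1 + of_int k1 * T \<in> {0..T}" using periodic_shift[OF T] .
  have y1K: "(y1, z1, t1 + of_int k1 * T) \<in> K" using k1 y1 z1 e by (simp add: K_def)
  have contF: "continuous_on U F"
    using C2_onD(2)[OF C] has_derivative_continuous by (blast intro: continuous_at_imp_continuous_on)
  have contx: "continuous_on UNIV x"
    using x1 DERIV_isCont by (blast intro: continuous_at_imp_continuous_on)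
  have cont\<rho>: "continuous_on UNIV \<rho>"
    unfolding \<rho>_def using linear_hyperplane_reflection by (rule linear_continuous_on[OF linear_conv_bounded_linear[THEN iffD1]])
  have "continuous_on K q"
  proof -
    have "continuous_on K (\<lambda>p. F (fst p, fst (snd p), snd (snd p)))"
      by (rule continuous_on_compose2[OF contF]) (use inU in \<open>auto simp: K_def intro!: continuous_intros\<close>)
    moreover have "continuous_on K (\<lambda>p. F (\<rho> (fst p), fst (snd p), snd (snd p)))"
      by (rule continuous_on_compose2[OF contF])
         (use inU \<rho>(1) in \<open>auto simp: K_def intro!: continuous_on_Pair continuous_on_fst continuous_on_snd
           continuous_on_id continuous_on_compose2[OF cont\<rho>]\<close>)
    moreover have "continuous_on K (\<lambda>p. x (snd (snd p)))"
      by (rule continuous_on_compose2[OF contx]) (auto intro!: continuous_intros)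
    moreover have "continuous_on K (\<lambda>p. g (fst p \<bullet> e))" unfolding g_def by (intro continuous_intros)
    moreover have "x (snd (snd p)) * g (fst p \<bullet> e) \<noteq> 0" if "p \<in> K" for p
      using upos[of "fst p" "snd (snd p)"] that by (auto simp: K_def)
    ultimately show ?thesis unfolding q_def v_def case_prod_unfold fst_conv snd_conv
      by (intro continuous_on_divide continuous_on_diff continuous_on_mult ballI)
  qed
  ultimately have "\<exists>p0\<in>K. \<forall>p\<in>K. q p \<le> q p0" using y1K by (intro continuous_attains_sup) auto
  then obtain p0 where p0: "p0 \<in> K" "\<And>p. p \<in> K \<Longrightarrow> q p \<le> q p0" by blast
  obtain a b s where abs: "p0 = (a, b, s)" by (cases p0)
  have a: "norm a = 1" "0 \<le> a \<bullet> e" and b: "norm b = 1" using p0(1) by (auto simp: abs K_def)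
  define m where "m = q p0"
  \<comment> \<open>By periodicity m x g - v is nonnegative for all real times, with the value 0 at
    (a, b, s). The second derivative test applies to it in each of the three factors.\<close>
  have le: "v (w, w', t) \<le> m * (x t * g (w \<bullet> e))" if w: "norm w = 1" "0 \<le> w \<bullet> e" "norm w' = 1" for w w' t
  proof -
    obtain k :: int where k: "t + of_int k * T \<in> {0..T}" using periodic_shift[OF T] .
    have F_k: "F (c, w', t + of_int k * T) = F (c, w', t)" if "norm c = 1" for c
      using periodic_int[of "\<lambda>t. F (c, w', t)" T] F_per that w by blast
    have "q (w, w', t + of_int k * T) \<le> m" unfolding m_def using k w by (intro p0(2)) (simp add: K_def)
    then have "v (w, w', t) / (x t * g (w \<bullet> e)) \<le> m"
      using F_k[OF w(1)] F_k[of "\<rho> w"] \<rho>(1) w periodic_int[of x T t k, OF x_per] by (simp add: q_def v_def)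
    then show ?thesis using upos[OF w(1,2)] by (simp add: pos_divide_le_eq)
  qed
  have eq: "v (a, b, s) = m * (x s * g (a \<bullet> e))"
  proof -
    have "m = v (a, b, s) / (x s * g (a \<bullet> e))" by (simp add: m_def abs q_def)
    then show ?thesis using upos[OF a, of s] by (metis nonzero_divide_eq_eq less_irrefl)
  qed
  have "0 < v (y1, z1, t1)" using neg e by (simp add: v_def)
  also have "\<dots> \<le> m * (x t1 * g (y1 \<bullet> e))" using le y1 z1 e by simp
  finally have m: "m > 0" using upos[of y1 t1] y1 e zero_less_mult_pos2 by (metis less_imp_le)
  \<comment> \<open>On the equator \<open>v\<close> vanishes while m x g is positive. The contact
    point therefore lies in the open hemisphere, and every unit vector near \<open>a\<close> is
    admissible.\<close>
  have ae: "0 < a \<bullet> e"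
  proof (rule ccontr)
    assume "\<not> 0 < a \<bullet> e"
    then have "v (a, b, s) = 0" using a \<rho>(2)[of a] by (simp add: v_def)
    then show False using eq mult_pos_pos[OF m upos[OF a, of s]] by linarith
  qed
  have \<rho>a: "norm (\<rho> a) = 1" using \<rho>(1) a by simp

  define H where "H = (\<lambda>w. sphere_lap_form (\<lambda>d. DF (w, b, s) (d, 0, 0)) (\<lambda>d c. HF (w, b, s) (d, 0, 0) (c, 0, 0)) w)"
  define H' where "H' = (\<lambda>w. sphere_lap_form (\<lambda>d. DF (w, b, s) (0, d, 0)) (\<lambda>d c. HF (w, b, s) (0, d, 0) (0, c, 0)) b)"
  define \<gamma> where "\<gamma> = - (2 * N * \<epsilon>) * (1 - (a \<bullet> e)\<^sup>2) - (N - 1) * (1 - 2 * N * \<epsilon> * (a \<bullet> e)) * (a \<bullet> e)"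
  \<comment> \<open>The tested function is F o \<rho> - F + m x(s) g. The reflection lemma
    identifies the Laplacian of its first term as \<open>H (\<rho> a)\<close>, and the zonal term
    contributes m x(s) \<gamma>.\<close>
  have y_part: "0 \<le> (H (\<rho> a) - H a) + m * x s * \<gamma>"
  proof -
    note C1 = C2_on_slices(1)[OF C, of b s]
    have blr: "bounded_linear \<rho>" unfolding \<rho>_def using linear_hyperplane_reflection linear_conv_bounded_linear by blast
    note C2 = C2_on_linear_comb[OF C2_on_linear_comb[OF C2_on_compose_affine[OF C1 blr, of 0] C1, of "-1"]
        C2_on_zonal, of "m * x s" e \<epsilon> N]
    have aS: "a \<in> ({w. 0 + \<rho> w \<in> {w. (w, b, s) \<in> U}} \<inter> {w. (w, b, s) \<in> U}) \<inter> UNIV"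
      using inU a b \<rho>a by simp
    have "open {w. 0 < w \<bullet> e}" by (intro open_Collect_less continuous_intros)
    then have "\<forall>\<^sub>F w in nhds a. 0 < w \<bullet> e" using eventually_nhds_in_open[of "{w. 0 < w \<bullet> e}" a] ae by simp
    then have "\<forall>\<^sub>F w in nhds a. norm w = 1 \<longrightarrow>
        F (0 + \<rho> a, b, s) + - 1 * F (a, b, s) + m * x s * (a \<bullet> e + \<epsilon> * (1 - N * (a \<bullet> e)\<^sup>2))
        \<le> F (0 + \<rho> w, b, s) + - 1 * F (w, b, s) + m * x s * (w \<bullet> e + \<epsilon> * (1 - N * (w \<bullet> e)\<^sup>2))"
    proof eventually_elim
      case (elim w)
      then show ?case using le[of w b s] eq b by (auto simp: v_def g_def mult.assoc)
    qed
    note fm = sphere_lap_form_local_min[OF C2 aS a(1) this, unfolded sphere_lap_form_linear_comb]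
    have lin: "linear (\<lambda>d. HF (\<rho> a, b, s) (d, 0, 0) (c, 0, 0))" "linear (\<lambda>c. HF (\<rho> a, b, s) (d, 0, 0) (c, 0, 0))" for c d
      using C2_on_bilinear[OF C1, of "\<rho> a"] inU \<rho>a b by auto
    show ?thesis
      using fm sphere_lap_form_reflection[OF e(1), of "\<lambda>d c. HF (\<rho> a, b, s) (d, 0, 0) (c, 0, 0)"
          "\<lambda>d. DF (\<rho> a, b, s) (d, 0, 0)" a, folded \<rho>_def, OF lin]
        sphere_lap_form_zonal[OF e(1) a(1), of "1 - 2 * N * \<epsilon> * (a \<bullet> e)" "- (2 * N * \<epsilon>)"]
      by (simp add: H_def \<gamma>_def N_def)
  qed
  have z_part: "0 \<le> H' (\<rho> a) - H' a"
  proof -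
    note C2 = C2_on_linear_comb[OF C2_on_slices(2)[OF C, of "\<rho> a" s] C2_on_slices(2)[OF C, of a s], of "-1"]
    have bS: "b \<in> {w. (\<rho> a, w, s) \<in> U} \<inter> {w. (a, w, s) \<in> U}"
      using inU a b \<rho>a by simp
    have "\<forall>\<^sub>F w in nhds b. norm w = 1 \<longrightarrow>
        F (\<rho> a, b, s) + - 1 * F (a, b, s) \<le> F (\<rho> a, w, s) + - 1 * F (a, w, s)"
    proof (intro always_eventually allI impI)
      fix w :: "real^'n" assume "norm w = 1"
      then show "F (\<rho> a, b, s) + - 1 * F (a, b, s) \<le> F (\<rho> a, w, s) + - 1 * F (a, w, s)"
        using le[OF a, of w s] eq by (simp add: v_def)
    qed
    from sphere_lap_form_local_min[OF C2 bS b this, unfolded sphere_lap_form_linear_comb]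
    show ?thesis by (simp add: H'_def)
  qed
  define J where "J w t = DF (w, b, t) (0, 0, 1)" for w t
  define J' where "J' w = HF (w, b, s) (0, 0, 1) (0, 0, 1)" for w
  \<comment> \<open>The vanishing first derivative is needed as well: it allows the drift terms with
    \<open>p s\<close> to cancel against those in the equation for \<open>x\<close>.\<close>
  have t_part: "(J (\<rho> a) s - J a s) + m * g (a \<bullet> e) * x' s = 0"
    "0 \<le> (J' (\<rho> a) - J' a) + m * g (a \<bullet> e) * (- p s * x' s - lam * x s + (N - 1) * x s / E s)"
  proof -
    note Cr = C2_on_real[OF C2_on_slices(3)[OF C, where z=b], where t=s, folded J_def J'_def]
    have S: "s \<in> {t. (w, b, t) \<in> U}" if "norm w = 1" for w using inU b that by simp
    let ?f = "\<lambda>t. F (\<rho> a, b, t) - F (a, b, t) + m * g (a \<bullet> e) * x t"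
    let ?f' = "\<lambda>t. J (\<rho> a) t - J a t + m * g (a \<bullet> e) * x' t"
    have 1: "\<forall>\<^sub>F t in nhds s. (?f has_real_derivative ?f' t) (at t)"
      using Cr(3)[OF S[OF \<rho>a]] Cr(3)[OF S[OF a(1)]]
    proof eventually_elim
      case (elim t)
      show ?case by (intro DERIV_add DERIV_diff DERIV_cmult elim x1)
    qed
    have 2: "(?f' has_real_derivative
       J' (\<rho> a) - J' a + m * g (a \<bullet> e) * (- p s * x' s - lam * x s + (N - 1) * x s / E s)) (at s)"
      unfolding N_def by (intro DERIV_add DERIV_diff DERIV_cmult Cr(2) S \<rho>a a x2)
    have 3: "\<forall>\<^sub>F t in nhds s. ?f s \<le> ?f t"
      by (intro always_eventually allI) (use le[OF a b] eq in \<open>simp add: v_def mult.left_commute mult.commute add.commute algebra_simps\<close>)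
    show "(J (\<rho> a) s - J a s) + m * g (a \<bullet> e) * x' s = 0"
      "0 \<le> (J' (\<rho> a) - J' a) + m * g (a \<bullet> e) * (- p s * x' s - lam * x s + (N - 1) * x s / E s)"
      using second_derivative_local_min[OF 1 2 3] by auto
  qed
  have "J' a + p s * J a s + H a / E s + H' a / G s = - mu * F (a, b, s)"
    "J' (\<rho> a) + p s * J (\<rho> a) s + H (\<rho> a) / E s + H' (\<rho> a) / G s = - mu * F (\<rho> a, b, s)"
    using eig[OF a(1) b, of s] eig[OF \<rho>a b, of s] by (auto simp: warped_lap_def J_def J'_def H_def H'_def)
  then have "(J' (\<rho> a) - J' a) + p s * (J (\<rho> a) s - J a s) + (H (\<rho> a) - H a) / E s + (H' (\<rho> a) - H' a) / G s
      = mu * v (a, b, s)"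
    by (simp add: v_def algebra_simps diff_divide_distrib)
  moreover have "(J (\<rho> a) s - J a s) = - m * g (a \<bullet> e) * x' s" using t_part(1) by simp
  moreover have "- (m * x s * \<gamma>) / E s \<le> (H (\<rho> a) - H a) / E s"
    using y_part pos(1)[of s] by (intro divide_right_mono) auto
  moreover have "0 \<le> (H' (\<rho> a) - H' a) / G s"
    using z_part pos(2)[of s] by simp
  \<comment> \<open>Subtracting the eigenvalue equations at \<open>a\<close> and
    \<open>\<rho> a\<close> and inserting the three tests leaves (lam - mu) E g \<le> (N - 1) g +
    \<gamma>, whereas the zonal inequality makes the right side smaller than \<eta> g.\<close>
  ultimately have "m * g (a \<bullet> e) * (lam * x s - (N - 1) * x s / E s) - m * x s * \<gamma> / E s
      \<le> mu * (m * (x s * g (a \<bullet> e)))"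
    using t_part(2) unfolding eq by (simp add: algebra_simps)
  then have "m * x s * ((lam - mu) * g (a \<bullet> e)) \<le> m * x s * ((N - 1) * g (a \<bullet> e) + \<gamma>) / E s"
    by (simp add: algebra_simps add_divide_distrib diff_divide_distrib)
  then have "m * x s * ((lam - mu) * g (a \<bullet> e)) * E s \<le> m * x s * ((N - 1) * g (a \<bullet> e) + \<gamma>)"
    using pos(1)[of s] by (simp only: pos_le_divide_eq)
  then have "m * x s * ((lam - mu) * E s * g (a \<bullet> e)) \<le> m * x s * ((N - 1) * g (a \<bullet> e) + \<gamma>)"
    by (simp add: algebra_simps)
  then have "(lam - mu) * E s * g (a \<bullet> e) \<le> (N - 1) * g (a \<bullet> e) + \<gamma>"
    using m pos(3)[of s] by simp
  moreover have "\<eta> * g (a \<bullet> e) \<le> (lam - mu) * E s * g (a \<bullet> e)"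
    unfolding \<eta>_def using Emin[of s] mu g(1)[OF a(2) ae1[OF a(1)]] by (intro mult_right_mono mult_left_mono) auto
  ultimately show False
    using g(2)[OF a(2) ae1[OF a(1)]] by (simp add: \<gamma>_def algebra_simps)
qed

section \<open>Sturm comparison\<close>

definition solves :: "(real \<Rightarrow> real) \<Rightarrow> real \<Rightarrow> (real \<Rightarrow> real) \<Rightarrow> (real \<Rightarrow> real) \<Rightarrow> bool" where
  "solves p mu f f' \<longleftrightarrow> (\<forall>t. (f has_real_derivative f' t) (at t) \<and>
      (f' has_real_derivative - p t * f' t - mu * f t) (at t))"

lemma solvesD:
  assumes "solves p mu f f'"
  shows "(f has_real_derivative f' t) (at t)" "(f' has_real_derivative - p t * f' t - mu * f t) (at t)"
  using assms unfolding solves_def by auto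

lemma solves_linear_comb:
  assumes "solves p mu f f'" "solves p mu g g'"
  shows "solves p mu (\<lambda>t. c * f t + d * g t) (\<lambda>t. c * f' t + d * g' t)"
  unfolding solves_def
proof (intro allI conjI)
  fix t
  show "((\<lambda>t. c * f t + d * g t) has_real_derivative c * f' t + d * g' t) (at t)"
    by (intro DERIV_add DERIV_cmult solvesD(1)[OF assms(1)] solvesD(1)[OF assms(2)])
  have "((\<lambda>t. c * f' t + d * g' t) has_real_derivative
      c * (- p t * f' t - mu * f t) + d * (- p t * g' t - mu * g t)) (at t)"
    by (intro DERIV_add DERIV_cmult solvesD(2)[OF assms(1)] solvesD(2)[OF assms(2)])
  then show "((\<lambda>t. c * f' t + d * g' t) has_real_derivative
      - p t * (c * f' t + d * g' t) - mu * (c * f t + d * g t)) (at t)"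
    by (simp add: algebra_simps)
qed

lemma DERIV_reflect:
  fixes f :: "real \<Rightarrow> real"
  assumes "(f has_real_derivative D) (at (c - t))"
  shows "((\<lambda>t. f (c - t)) has_real_derivative - D) (at t)"
proof -
  have "((\<lambda>t. c - t) has_real_derivative - 1) (at t)" by (auto intro!: derivative_eq_intros)
  from DERIV_chain2[OF assms this] show ?thesis by simp
qed

text \<open>The drift is odd about c/2 and \<open>f'\<close> changes sign under the reflection, so
  the product in the first-order term keeps its form.\<close>

lemma solves_reflect:
  assumes f: "solves p mu f f'" and p: "\<And>t. p (c - t) = - p t"
  shows "solves p mu (\<lambda>t. f (c - t)) (\<lambda>t. - f' (c - t))"
  unfolding solves_def
proof (intro allI conjI)
  fix t
  show "((\<lambda>t. f (c - t)) has_real_derivative - f' (c - t)) (at t)"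
    by (rule DERIV_reflect[OF solvesD(1)[OF f]])
  have "((\<lambda>t. - f' (c - t)) has_real_derivative - (- (- p (c - t) * f' (c - t) - mu * f (c - t)))) (at t)"
    by (intro DERIV_minus DERIV_reflect solvesD(2)[OF f])
  then show "((\<lambda>t. - f' (c - t)) has_real_derivative - p t * - f' (c - t) - mu * f (c - t)) (at t)"
    by (simp add: p algebra_simps)
qed

text \<open>The integrating factor W' = p W makes the derivative of W (f u' - f' u) equal to W f
  (u'' + p u' + mu u): the terms mu f u cancel. The sign of \<open>u\<close> does not enter.\<close>

lemma wronskian_strict_decrease:
  fixes W :: "real \<Rightarrow> real"
  assumes ab: "a < b" and W: "\<And>t. W t > 0" "\<And>t. (W has_real_derivative p t * W t) (at t)"
    and f: "solves p mu f f'"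
    and u: "\<And>t. (u has_real_derivative u' t) (at t)" "\<And>t. (u' has_real_derivative u'' t) (at t)"
    and pos: "\<And>t. a < t \<Longrightarrow> t < b \<Longrightarrow> f t > 0"
    and super: "\<And>t. a < t \<Longrightarrow> t < b \<Longrightarrow> u'' t + p t * u' t + mu * u t < 0"
  shows "W b * (f b * u' b - f' b * u b) < W a * (f a * u' a - f' a * u a)"
proof -
  define w where "w = (\<lambda>t. W t * (f t * u' t - f' t * u t))"
  have d: "(w has_real_derivative W t * f t * (u'' t + p t * u' t + mu * u t)) (at t)" for t
  proof -
    have "(w has_real_derivative p t * W t * (f t * u' t - f' t * u t) +
        ((f' t * u' t + u'' t * f t) - ((- p t * f' t - mu * f t) * u t + u' t * f' t)) * W t) (at t)"
      unfolding w_def by (intro DERIV_mult DERIV_diff W u solvesD[OF f])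
    then show ?thesis by (simp add: algebra_simps)
  qed
  have "w b < w a"
  proof (rule DERIV_neg_imp_decreasing_open[OF ab])
    fix t assume "a < t" "t < b"
    then show "\<exists>y. DERIV w t :> y \<and> y < 0"
      using d[of t] W(1)[of t] pos super by (blast intro: mult_pos_neg mult_pos_pos)
  next
    show "continuous_on {a..b} w"
      using d by (intro continuous_at_imp_continuous_on ballI DERIV_isCont) blast
  qed
  then show ?thesis by (simp add: w_def)
qed

text \<open>\<open>a\<close> is the last point of [A, c] where f \<le> 0, if there is one. There
  \<open>f\<close> vanishes by continuity and \<open>f'\<close> cannot be negative; otherwise
  \<open>a = A\<close>.\<close>

lemma positivity_left_end:
  fixes f :: "real \<Rightarrow> real"
  assumes f: "\<And>t. (f has_real_derivative f' t) (at t)" and c: "f c > 0" "A \<le> c"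
  obtains a where "A \<le> a" "a \<le> c" "\<And>t. a < t \<Longrightarrow> t \<le> c \<Longrightarrow> f t > 0" "f a = 0 \<and> 0 \<le> f' a \<or> a = A \<and> f a > 0"
proof (cases "\<exists>s\<in>{A..c}. f s \<le> 0")
  case False
  then show ?thesis using c by (intro that[of A]) (auto simp: not_le)
next
  case True
  have cont: "continuous_on S f" for S using f DERIV_isCont by (blast intro: continuous_at_imp_continuous_on)
  define Z where "Z = {A..c} \<inter> f -` {..0}"
  have "closed Z" unfolding Z_def by (intro continuous_closed_preimage cont) auto
  moreover have "bounded Z" unfolding Z_def by (rule bounded_subset[OF bounded_closed_interval Int_lower1])
  ultimately have "compact Z" by (simp add: compact_eq_bounded_closed)
  moreover have "Z \<noteq> {}" using True by (auto simp: Z_def)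
  ultimately have "\<exists>a\<in>Z. \<forall>t\<in>Z. t \<le> a" by (rule compact_attains_sup)
  then obtain a where a: "a \<in> Z" "\<And>t. t \<in> Z \<Longrightarrow> t \<le> a" by blast
  have pos: "f t > 0" if "a < t" "t \<le> c" for t
    using a(2)[of t] that a(1) by (cases "f t \<le> 0") (auto simp: Z_def)
  have ac: "a < c" using a(1) c by (cases "a = c") (auto simp: Z_def)
  have fa: "f a = 0"
  proof (rule ccontr)
    assume "f a \<noteq> 0"
    then have "f a < 0" using a by (simp add: Z_def)
    moreover have "0 \<le> f c" using c by simp
    ultimately obtain x where x: "a \<le> x" "x \<le> c" "f x = 0"
      using IVT'[of f a 0 c] ac cont by auto
    then have "x \<noteq> a" using \<open>f a < 0\<close> by auto
    then show False using pos[of x] x by simp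
  qed
  have "0 \<le> f' a"
  proof (rule ccontr)
    assume "\<not> 0 \<le> f' a"
    then obtain d where d: "d > 0" "\<And>h. 0 < h \<Longrightarrow> h < d \<Longrightarrow> f (a + h) < f a"
      using DERIV_neg_dec_right[OF f] by (auto simp: not_le)
    define h where "h = min d (c - a) / 2"
    have "0 < h" "h < d" "a + h \<le> c" using d(1) ac by (auto simp: h_def min_def field_simps)
    then show False using d(2)[of h] pos[of "a + h"] fa by simp
  qed
  then show ?thesis using a fa pos by (intro that[of a]) (auto simp: Z_def)
qed

lemma positivity_interval:
  fixes f :: "real \<Rightarrow> real"
  assumes f: "\<And>t. (f has_real_derivative f' t) (at t)" and c: "f c > 0" "A \<le> c" "c \<le> B" and AB: "A < B"
  obtains a b where "A \<le> a" "a < b" "b \<le> B" "\<And>t. a < t \<Longrightarrow> t < b \<Longrightarrow> f t > 0"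
    "f a = 0 \<and> 0 \<le> f' a \<or> a = A \<and> f a > 0" "f b = 0 \<and> f' b \<le> 0 \<or> b = B \<and> f b > 0"
proof -
  obtain a where a: "A \<le> a" "a \<le> c" "\<And>t. a < t \<Longrightarrow> t \<le> c \<Longrightarrow> f t > 0" "f a = 0 \<and> 0 \<le> f' a \<or> a = A \<and> f a > 0"
    using positivity_left_end[OF f c(1,2)] by blast
  have "((\<lambda>t. f (0 - t)) has_real_derivative - f' (0 - t)) (at t)" for t by (rule DERIV_reflect[OF f])
  then obtain b where b: "- B \<le> b" "b \<le> - c" "\<And>t. b < t \<Longrightarrow> t \<le> - c \<Longrightarrow> f (- t) > 0"
    "f (- b) = 0 \<and> 0 \<le> - f' (- b) \<or> b = - B \<and> f (- b) > 0"
    using positivity_left_end[of "\<lambda>t. f (- t)" "\<lambda>t. - f' (- t)" "- c" "- B"] c by auto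
  show ?thesis
  proof (rule that[of a "- b"])
    \<comment> \<open>\<open>c\<close> may be an end of [A, B]. Since f c > 0, \<open>a = c\<close>
      forces \<open>c = A\<close> and \<open>- b = c\<close> forces \<open>c = B\<close>, which
      cannot both happen.\<close>
    show "a < - b" using a b c(1) AB by (cases "a = c"; cases "b = - c") auto
    show "f t > 0" if "a < t" "t < - b" for t
      using a(3)[of t] b(3)[of "- t"] that by (cases "t \<le> c") auto
  qed (use a b in auto)
qed

text \<open>On a maximal interval where f > 0, the weighted Wronskian is at most 0 at the left end
  and at least 0 at the right end, against its strict decrease. At an inner zero the sign of
  \<open>f'\<close> decides, at a Neumann end the sign of \<open>u'\<close>.\<close>

lemma comparison_le_0:
  fixes W :: "real \<Rightarrow> real"
  assumes AB: "A < B" and W: "\<And>t. W t > 0" "\<And>t. (W has_real_derivative p t * W t) (at t)"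
    and f: "solves p mu f f'"
    and u: "\<And>t. (u has_real_derivative u' t) (at t)" "\<And>t. (u' has_real_derivative u'' t) (at t)"
    and super: "\<And>t. A < t \<Longrightarrow> t < B \<Longrightarrow> u'' t + p t * u' t + mu * u t < 0"
    and u_nonneg: "\<And>t. A \<le> t \<Longrightarrow> t \<le> B \<Longrightarrow> 0 \<le> u t"
    and bdA: "f A = 0 \<or> f' A = 0 \<and> u' A \<le> 0"
    and bdB: "f B = 0 \<or> f' B = 0 \<and> 0 \<le> u' B"
    and c: "A \<le> c" "c \<le> B"
  shows "f c \<le> 0"
proof (rule ccontr)
  assume "\<not> f c \<le> 0"
  then have "f c > 0" by simp
  from positivity_interval[OF solvesD(1)[OF f] this c AB]
  obtain a b where ab: "A \<le> a" "a < b" "b \<le> B" "\<And>t. a < t \<Longrightarrow> t < b \<Longrightarrow> f t > 0"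
    "f a = 0 \<and> 0 \<le> f' a \<or> a = A \<and> f a > 0" "f b = 0 \<and> f' b \<le> 0 \<or> b = B \<and> f b > 0" by blast
  have "W b * (f b * u' b - f' b * u b) < W a * (f a * u' a - f' a * u a)"
    by (rule wronskian_strict_decrease[OF ab(2) W f u ab(4) super]) (use ab in auto)
  moreover have "W a * (f a * u' a - f' a * u a) \<le> 0"
    using W(1)[of a] ab bdA u_nonneg[of a] by (intro mult_nonneg_nonpos) (auto simp: mult_nonneg_nonpos)
  moreover have "0 \<le> W b * (f b * u' b - f' b * u b)"
    using W(1)[of b] ab bdB u_nonneg[of b] by (intro mult_nonneg_nonneg) (auto simp: mult_nonpos_nonneg)
  ultimately show False by linarith
qed

lemma comparison_vanishes:
  fixes W :: "real \<Rightarrow> real"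
  assumes "A < B" "\<And>t. W t > 0" "\<And>t. (W has_real_derivative p t * W t) (at t)"
    and f: "solves p mu f f'"
    and "\<And>t. (u has_real_derivative u' t) (at t)" "\<And>t. (u' has_real_derivative u'' t) (at t)"
    and "\<And>t. A < t \<Longrightarrow> t < B \<Longrightarrow> u'' t + p t * u' t + mu * u t < 0"
    and "\<And>t. A \<le> t \<Longrightarrow> t \<le> B \<Longrightarrow> 0 \<le> u t"
    and "f A = 0 \<or> f' A = 0 \<and> u' A \<le> 0"
    and "f B = 0 \<or> f' B = 0 \<and> 0 \<le> u' B"
    and "A \<le> c" "c \<le> B"
  shows "f c = 0"
proof -
  have g: "solves p mu (\<lambda>t. - f t) (\<lambda>t. - f' t)" using solves_linear_comb[OF f f, of "-1" 0] by simp
  have "f c \<le> 0" by (rule comparison_le_0[where f=f and f'=f' and W=W and p=p and mu=mu and u=u and u'=u' and u''=u'' and A=A and B=B]) (use assms in auto)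
  moreover have "- f c \<le> 0" by (rule comparison_le_0[where f="\<lambda>t. - f t" and f'="\<lambda>t. - f' t" and W=W and p=p and mu=mu and u=u and u'=u' and u''=u'' and A=A and B=B]) (use assms g in auto)
  ultimately show ?thesis by simp
qed

lemma wronskian_constant:
  fixes W :: "real \<Rightarrow> real"
  assumes W: "\<And>t. (W has_real_derivative p t * W t) (at t)"
    and f: "solves p mu f f'" and u: "solves p mu u u'"
  shows "W t * (f t * u' t - f' t * u t) = W 0 * (f 0 * u' 0 - f' 0 * u 0)"
proof -
  have "\<forall>t. ((\<lambda>t. W t * (f t * u' t - f' t * u t)) has_real_derivative 0) (at t)"
  proof
    fix t
    have "((\<lambda>t. W t * (f t * u' t - f' t * u t)) has_real_derivative p t * W t * (f t * u' t - f' t * u t) +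
        ((f' t * u' t + (- p t * u' t - mu * u t) * f t) - ((- p t * f' t - mu * f t) * u t + u' t * f' t)) * W t) (at t)"
      by (intro DERIV_mult DERIV_diff W solvesD[OF f] solvesD[OF u])
    then show "((\<lambda>t. W t * (f t * u' t - f' t * u t)) has_real_derivative 0) (at t)"
      by (simp add: algebra_simps)
  qed
  from DERIV_isconst_all[OF this, of t 0] show ?thesis .
qed

text \<open>Both Wronskians of \<open>k\<close> against the fundamental system are constant; eliminating \<open>k'\<close>
  from them determines \<open>k\<close>.\<close>
lemma solution_space:
  fixes W :: "real \<Rightarrow> real"
  assumes W: "\<And>t. W t > 0" "\<And>t. (W has_real_derivative p t * W t) (at t)"
    and f: "solves p mu f f'" "f 0 = 1" "f' 0 = 0" and u: "solves p mu u u'" "u 0 = 0" "u' 0 = 1"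
    and k: "solves p mu k k'"
  shows "k t = k 0 * f t + k' 0 * u t" "k' t = k' 0 * u' t + k 0 * f' t"
proof -
  have eq: "k t = k 0 * f t + k' 0 * u t" for t
  proof -
    have w: "W t * (f t * u' t - f' t * u t) = W 0" "W t * (k t * u' t - k' t * u t) = W 0 * k 0"
      "W t * (k t * f' t - k' t * f t) = - W 0 * k' 0"
      using wronskian_constant[OF W(2) f(1) u(1), of t] wronskian_constant[OF W(2) k u(1), of t]
        wronskian_constant[OF W(2) k f(1), of t] f u by simp_all
    have "(W t * (f t * u' t - f' t * u t)) * k t = (W t * (k t * u' t - k' t * u t)) * f t
        - (W t * (k t * f' t - k' t * f t)) * u t"
      by (simp add: algebra_simps)
    then have "W 0 * k t = W 0 * (k 0 * f t + k' 0 * u t)" unfolding w by (simp add: algebra_simps)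
    then show ?thesis using W(1)[of 0] by simp
  qed
  show "k t = k 0 * f t + k' 0 * u t" by (rule eq)
  have "((\<lambda>t. k 0 * f t + k' 0 * u t) has_real_derivative k 0 * f' t + k' 0 * u' t) (at t)"
    by (intro DERIV_add DERIV_cmult solvesD(1)[OF f(1)] solvesD(1)[OF u(1)])
  moreover have "(\<lambda>t. k 0 * f t + k' 0 * u t) = k" by (rule ext) (rule eq[symmetric])
  ultimately have "(k has_real_derivative k 0 * f' t + k' 0 * u' t) (at t)" by (simp only:)
  from DERIV_unique[OF solvesD(1)[OF k, of t] this]
  show "k' t = k' 0 * u' t + k 0 * f' t" by simp
qed

section \<open>The profile curve\<close>

text \<open>With \<open>S, C\<close> the sine and cosine of \<open>r\<close>, \<open>s, c\<close> those of \<open>\<theta>\<close> and \<open>a, b\<close> those of \<open>\<alpha>\<close>, this is the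
  equation for \<open>sin r cos \<theta>\<close>; replacing \<open>(c, s)\<close> by \<open>(s, - c)\<close> gives the one for \<open>sin r sin \<theta>\<close>.\<close>
lemma coordinate_ode_identity:
  fixes S C s c a b N :: real
  assumes "S \<noteq> 0" "c \<noteq> 0" "s \<noteq> 0"
    and P: "S\<^sup>2 + C\<^sup>2 = 1" "s\<^sup>2 + c\<^sup>2 = 1" "a\<^sup>2 + b\<^sup>2 = 1"
  defines "A \<equiv> ((N - 1) * b * (c / s - s / c) - (2 * N - 1) * C * a) / S"
  defines "p \<equiv> (N - 1) * (2 * C * b / S + (c / s - s / c) * a / S)"
  shows "- (S * b) * b * c - C * (a * A) * c - C * b * (s * (a / S)) - (c * (a / S)) * a - s * (b * A)
    = - p * (C * b * c - s * a) - (2 * N - 1) * (S * c) + (N - 1) * (S * c) / (S\<^sup>2 * c\<^sup>2)"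
proof -
  \<comment> \<open>With \<open>i\<close> for 1/c and \<kappa> for cot \<theta> - tan \<theta>, the
    relations c i = 1 and \<kappa> s = c - s^2 i are polynomial; after multiplication by
    \<open>S\<close> the claim is an ideal membership.\<close>
  define \<kappa> where "\<kappa> = c / s - s / c"
  define i where "i = 1 / c"
  have i: "c * i = 1" using assms by (simp add: i_def)
  have k: "\<kappa> * s = c - s\<^sup>2 * i" using assms by (simp add: \<kappa>_def i_def power2_eq_square field_simps)
  define B where "B = (N - 1) * b * \<kappa> - (2 * N - 1) * C * a"
  define q where "q = (N - 1) * (2 * C * b + \<kappa> * a)"
  have "- (S\<^sup>2 * b\<^sup>2 * c) - C * a * B * c - C * b * s * a - c * a\<^sup>2 - s * b * B
    = - q * (C * b * c - s * a) - (2 * N - 1) * (S\<^sup>2 * c) + (N - 1) * i"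
    using P i k unfolding B_def q_def by algebra
  moreover have "A = B / S" by (simp add: A_def B_def \<kappa>_def)
  moreover have "p = q / S" unfolding p_def q_def \<kappa>_def by (metis add_divide_distrib times_divide_eq_right)
  moreover have "(N - 1) * (S * c) / (S\<^sup>2 * c\<^sup>2) = (N - 1) * i / S"
    using assms by (simp add: i_def power2_eq_square field_simps)
  moreover define a' R where "a' = a / S" and "R = (N - 1) * (S * c) / (S\<^sup>2 * c\<^sup>2)"
  ultimately have *: "S * A = B" "S * p = q" "S * R = (N - 1) * i" "S * a' = a"
    "- (S\<^sup>2 * b\<^sup>2 * c) - C * a * B * c - C * b * s * a - c * a\<^sup>2 - s * b * B
      = - q * (C * b * c - s * a) - (2 * N - 1) * (S\<^sup>2 * c) + (N - 1) * i"
    using \<open>S \<noteq> 0\<close> by simp_all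
  have "S * (- (S * b) * b * c - C * (a * A) * c - C * b * (s * a') - (c * a') * a - s * (b * A))
    = - (S\<^sup>2 * b\<^sup>2 * c) - C * a * (S * A) * c - C * b * s * (S * a') - c * (S * a') * a - s * b * (S * A)"
    by (simp add: power2_eq_square algebra_simps)
  also have "\<dots> = - (S * p) * (C * b * c - s * a) - (2 * N - 1) * (S\<^sup>2 * c) + S * R"
    unfolding *(1-4) *(5)[symmetric] by (simp add: power2_eq_square)
  also have "\<dots> = S * (- p * (C * b * c - s * a) - (2 * N - 1) * (S * c) + R)"
    by (simp add: power2_eq_square algebra_simps)
  finally show ?thesis using \<open>S \<noteq> 0\<close> unfolding a'_def R_def by (simp only: mult_cancel_left) simp
qed

text \<open>This is the equation for -cos r. After multiplying out, the \<kappa> terms cancel and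
  the remainder is (2N - 1) C (a^2 + b^2 - 1).\<close>

lemma height_ode_identity:
  fixes S C \<kappa> a b N :: real
  assumes "S \<noteq> 0" and P: "S\<^sup>2 + C\<^sup>2 = 1" "a\<^sup>2 + b\<^sup>2 = 1"
  defines "A \<equiv> ((N - 1) * b * \<kappa> - (2 * N - 1) * C * a) / S"
  defines "p \<equiv> (N - 1) * (2 * C * b / S + \<kappa> * a / S)"
  shows "C * b * b - S * (a * A) = - p * (S * b) - (2 * N - 1) * - C"
proof -
  have "S * A = (N - 1) * b * \<kappa> - (2 * N - 1) * C * a" "p * S = (N - 1) * (2 * C * b + \<kappa> * a)"
    using assms by (simp_all add: field_simps)
  then show ?thesis using P(2) by algebra
qed

text \<open>Here \<open>n\<close> is a plain number; the lemmas on the spectrum tie it to the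
  cardinality of the index type.\<close>

locale carlotto_schulz =
  fixes r \<theta> \<alpha> :: "real \<Rightarrow> real" and T :: real and n :: nat
  assumes n_gt: "n > 1" and T_pos: "T > 0"
    and r_ode: "\<And>t. (r has_real_derivative cos (\<alpha> t)) (at t)"
    and \<theta>_ode: "\<And>t. (\<theta> has_real_derivative sin (\<alpha> t) / sin (r t)) (at t)"
    and \<alpha>_ode: "\<And>t. (\<alpha> has_real_derivative
            (2 * real n - 2) / sin (r t) * cos (\<alpha> t) * cot (2 * \<theta> t)
          - (2 * real n - 1) * cot (r t) * sin (\<alpha> t)) (at t)"
    and init: "r 0 = pi / 2" "\<alpha> 0 = 0"
    and periodic: "\<And>t. r (t + T) = r t" "\<And>t. \<theta> (t + T) = \<theta> t" "\<And>t. \<alpha> (t + T) = \<alpha> t + 2 * pi"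
    and symm: "\<And>t. \<theta> (- t) = \<theta> t" "\<And>t. \<theta> (T / 2 - t) = pi / 2 - \<theta> t"
              "\<And>t. r (- t) = pi - r t" "\<And>t. r (T / 2 - t) = r t"
              "\<And>t. \<alpha> (- t) = - \<alpha> t" "\<And>t. \<alpha> (T / 2 - t) = pi - \<alpha> t"
    and mono: "strict_mono_on {0..T / 2} \<theta>" "strict_mono_on {- T / 4..T / 4} r"
    and ranges: "\<And>t. 0 < \<theta> t \<and> \<theta> t < pi / 2" "\<And>t. 0 < r t \<and> r t < pi"
begin

lemma trig_pos: "0 < sin (r t)" "0 < sin (\<theta> t)" "0 < cos (\<theta> t)"
  using ranges[of t] by (auto intro: sin_gt_zero cos_gt_zero)

definition drift :: "real \<Rightarrow> real" where
  "drift t = (real n - 1) / 2 * deriv (\<lambda>s. ln (CS_E r \<theta> s * CS_G r \<theta> s)) t"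

definition lam :: real where "lam = 2 * real n - 1"

text \<open>The volume density (E G)^((n-1)/2), which puts the equation into the self-adjoint form
  (weight f')' = - mu weight f.\<close>

definition weight :: "real \<Rightarrow> real" where
  "weight t = exp ((real n - 1) / 2 * ln (CS_E r \<theta> t * CS_G r \<theta> t))"

text \<open>Equal to 2 cot(2\<theta>); the split form suits rational identities in the sine and
  cosine of \<theta>.\<close>

definition cotd :: "real \<Rightarrow> real" where
  "cotd t = cos (\<theta> t) / sin (\<theta> t) - sin (\<theta> t) / cos (\<theta> t)"

lemma EG_pos: "0 < CS_E r \<theta> t" "0 < CS_G r \<theta> t"
  using trig_pos[of t] by (simp_all add: CS_E_def CS_G_def)

lemma \<alpha>_deriv:
  "(\<alpha> has_real_derivative ((real n - 1) * cos (\<alpha> t) * cotd t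
      - (2 * real n - 1) * cos (r t) * sin (\<alpha> t)) / sin (r t)) (at t)"
proof -
  have "2 * cot (2 * \<theta> t) = ((cos (\<theta> t))\<^sup>2 - (sin (\<theta> t))\<^sup>2) / (sin (\<theta> t) * cos (\<theta> t))"
    unfolding cot_def sin_double cos_double using trig_pos[of t] by (simp add: field_simps)
  also have "\<dots> = cotd t"
    using trig_pos[of t] by (simp add: cotd_def power2_eq_square field_simps)
  finally have "2 * cot (2 * \<theta> t) = cotd t" .
  moreover have "(2 * real n - 2) / sin (r t) * cos (\<alpha> t) * cot (2 * \<theta> t)
      - (2 * real n - 1) * cot (r t) * sin (\<alpha> t)
    = ((real n - 1) * cos (\<alpha> t) * (2 * cot (2 * \<theta> t)) - (2 * real n - 1) * cos (r t) * sin (\<alpha> t)) / sin (r t)"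
  proof -
    have cot: "cot (r t) = cos (r t) / sin (r t)" by (simp add: cot_def)
    show ?thesis unfolding cot using trig_pos(1)[of t] by (simp add: field_simps)
  qed
  ultimately show ?thesis using \<alpha>_ode[of t] by simp
qed

lemma ln_EG_deriv:
  "((\<lambda>s. ln (CS_E r \<theta> s * CS_G r \<theta> s)) has_real_derivative
      2 * (2 * cos (r t) * cos (\<alpha> t) / sin (r t) + cotd t * sin (\<alpha> t) / sin (r t))) (at t)"
proof -
  have eq: "ln (CS_E r \<theta> s * CS_G r \<theta> s) = 4 * ln (sin (r s)) + 2 * ln (sin (\<theta> s)) + 2 * ln (cos (\<theta> s))" for s
    using trig_pos[of s] by (simp add: CS_E_def CS_G_def ln_mult ln_realpow)
  show ?thesis unfolding eq
    using trig_pos[of t]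
    by (auto intro!: derivative_eq_intros r_ode \<theta>_ode simp: cotd_def field_simps)
qed

lemma drift_eq: "drift t = (real n - 1) * (2 * cos (r t) * cos (\<alpha> t) / sin (r t) + cotd t * sin (\<alpha> t) / sin (r t))"
  unfolding drift_def DERIV_imp_deriv[OF ln_EG_deriv] by simp

lemma weight: "weight t > 0" "(weight has_real_derivative drift t * weight t) (at t)"
proof -
  show "weight t > 0" by (simp add: weight_def)
  obtain D where D: "((\<lambda>s. ln (CS_E r \<theta> s * CS_G r \<theta> s)) has_real_derivative D) (at t)"
    using ln_EG_deriv by blast
  have "(weight has_real_derivative weight t * ((real n - 1) / 2 * D)) (at t)"
    unfolding weight_def[abs_def] by (intro DERIV_fun_exp DERIV_cmult D)
  then show "(weight has_real_derivative drift t * weight t) (at t)"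
    unfolding drift_def DERIV_imp_deriv[OF D] by (simp only: mult.commute)
qed

text \<open>The reflection about 0 preserves \<open>E\<close> and \<open>G\<close>, the one about
  T/4 exchanges them. Their product is even about both points, so its logarithmic derivative is
  odd.\<close>

lemma drift_symm: "drift (- t) = - drift t" "drift (T / 2 - t) = - drift t"
proof -
  have "cos (r (- t)) = - cos (r t)" "sin (r (- t)) = sin (r t)" "cos (\<alpha> (- t)) = cos (\<alpha> t)"
    "sin (\<alpha> (- t)) = - sin (\<alpha> t)" "cotd (- t) = cotd t"
    by (simp_all add: symm cotd_def)
  then show "drift (- t) = - drift t" unfolding drift_eq by (simp add: algebra_simps)
  have "r (T / 2 - t) = r t" "cos (\<alpha> (T / 2 - t)) = - cos (\<alpha> t)" "sin (\<alpha> (T / 2 - t)) = sin (\<alpha> t)"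
    by (simp_all add: symm)
  moreover have "cos (\<theta> (T / 2 - t)) = sin (\<theta> t)" "sin (\<theta> (T / 2 - t)) = cos (\<theta> t)"
    unfolding symm by (simp_all add: sin_diff cos_diff)
  then have "cotd (T / 2 - t) = - cotd t" by (simp add: cotd_def)
  ultimately show "drift (T / 2 - t) = - drift t" unfolding drift_eq by (simp add: algebra_simps)
qed

text \<open>The sign makes the function positive on (0, T/2), where r > pi/2.\<close>

definition height :: "real \<Rightarrow> real" where "height t = - cos (r t)"
definition height' :: "real \<Rightarrow> real" where "height' t = sin (r t) * cos (\<alpha> t)"

lemma solves_height: "solves drift lam height height'"
  unfolding solves_def
proof (intro allI conjI)
  fix t
  show "(height has_real_derivative height' t) (at t)"
    unfolding height_def[abs_def] height'_def by (auto intro!: derivative_eq_intros r_ode)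
  define A where "A = ((real n - 1) * cos (\<alpha> t) * cotd t
      - (2 * real n - 1) * cos (r t) * sin (\<alpha> t)) / sin (r t)"
  have "(height' has_real_derivative cos (r t) * cos (\<alpha> t) * cos (\<alpha> t) - sin (r t) * (sin (\<alpha> t) * A)) (at t)"
    unfolding height'_def[abs_def] A_def
    by (auto intro!: derivative_eq_intros r_ode \<alpha>_deriv)
  then show "(height' has_real_derivative - drift t * height' t - lam * height t) (at t)"
    unfolding drift_eq lam_def height_def height'_def A_def
    using height_ode_identity[of "sin (r t)" "cos (r t)" "sin (\<alpha> t)" "cos (\<alpha> t)" "real n" "cotd t"] trig_pos(1)[of t]
    by simp
qed

text \<open>\<open>xc\<close> and \<open>yc\<close> are the radii of the two sphere factors in X =
  (xc y, yc z, cos r); thus E = xc^2 and G = yc^2.\<close>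

definition xc :: "real \<Rightarrow> real" where "xc t = sin (r t) * cos (\<theta> t)"
definition xc' :: "real \<Rightarrow> real" where "xc' t = cos (r t) * cos (\<alpha> t) * cos (\<theta> t) - sin (\<theta> t) * sin (\<alpha> t)"
definition yc :: "real \<Rightarrow> real" where "yc t = sin (r t) * sin (\<theta> t)"
definition yc' :: "real \<Rightarrow> real" where "yc' t = cos (r t) * cos (\<alpha> t) * sin (\<theta> t) + cos (\<theta> t) * sin (\<alpha> t)"

lemma xc_deriv:
  "(xc has_real_derivative xc' t) (at t)"
  "(xc' has_real_derivative - drift t * xc' t - lam * xc t + (real n - 1) * xc t / CS_E r \<theta> t) (at t)"
proof -
  show "(xc has_real_derivative xc' t) (at t)"
    unfolding xc_def[abs_def] xc'_def using trig_pos(1)[of t]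
    by (auto intro!: derivative_eq_intros r_ode \<theta>_ode simp: algebra_simps)
  define A where "A = ((real n - 1) * cos (\<alpha> t) * cotd t
      - (2 * real n - 1) * cos (r t) * sin (\<alpha> t)) / sin (r t)"
  define B where "B = sin (\<alpha> t) / sin (r t)"
  note derivs = r_ode[of t] \<alpha>_deriv[of t, folded A_def] \<theta>_ode[of t, folded B_def]
  have "(xc' has_real_derivative - (sin (r t) * cos (\<alpha> t)) * cos (\<alpha> t) * cos (\<theta> t) - cos (r t) * (sin (\<alpha> t) * A) * cos (\<theta> t)
     - cos (r t) * cos (\<alpha> t) * (sin (\<theta> t) * B)
     - (cos (\<theta> t) * B) * sin (\<alpha> t) - sin (\<theta> t) * (cos (\<alpha> t) * A)) (at t)"
    unfolding xc'_def[abs_def] by (auto intro!: derivative_eq_intros derivs simp: algebra_simps)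
  then show "(xc' has_real_derivative - drift t * xc' t - lam * xc t + (real n - 1) * xc t / CS_E r \<theta> t) (at t)"
    unfolding drift_eq lam_def xc_def xc'_def A_def B_def CS_E_def
    using coordinate_ode_identity[of "sin (r t)" "cos (\<theta> t)" "sin (\<theta> t)" "cos (r t)" "sin (\<alpha> t)" "cos (\<alpha> t)" "real n", folded cotd_def]
      trig_pos[of t]
    by simp
qed

lemma yc_deriv:
  "(yc has_real_derivative yc' t) (at t)"
  "(yc' has_real_derivative - drift t * yc' t - lam * yc t + (real n - 1) * yc t / CS_G r \<theta> t) (at t)"
proof -
  show "(yc has_real_derivative yc' t) (at t)"
    unfolding yc_def[abs_def] yc'_def using trig_pos(1)[of t]
    by (auto intro!: derivative_eq_intros r_ode \<theta>_ode simp: algebra_simps)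
  define A where "A = ((real n - 1) * cos (\<alpha> t) * cotd t
      - (2 * real n - 1) * cos (r t) * sin (\<alpha> t)) / sin (r t)"
  have *: "sin (\<theta> t) / - cos (\<theta> t) - - cos (\<theta> t) / sin (\<theta> t) = cotd t" by (simp add: cotd_def)
  define B where "B = sin (\<alpha> t) / sin (r t)"
  note derivs = r_ode[of t] \<alpha>_deriv[of t, folded A_def] \<theta>_ode[of t, folded B_def]
  have "(yc' has_real_derivative - (sin (r t) * cos (\<alpha> t)) * cos (\<alpha> t) * sin (\<theta> t) - cos (r t) * (sin (\<alpha> t) * A) * sin (\<theta> t)
     - cos (r t) * cos (\<alpha> t) * (- cos (\<theta> t) * B)
     - (sin (\<theta> t) * B) * sin (\<alpha> t) - - cos (\<theta> t) * (cos (\<alpha> t) * A)) (at t)"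
    unfolding yc'_def[abs_def] by (auto intro!: derivative_eq_intros derivs simp: algebra_simps)
  then show "(yc' has_real_derivative - drift t * yc' t - lam * yc t + (real n - 1) * yc t / CS_G r \<theta> t) (at t)"
    unfolding drift_eq lam_def yc_def yc'_def A_def B_def CS_G_def
    using coordinate_ode_identity[of "sin (r t)" "sin (\<theta> t)" "- cos (\<theta> t)" "cos (r t)" "sin (\<alpha> t)" "cos (\<alpha> t)" "real n", unfolded *]
      trig_pos[of t]
    by simp
qed

lemma quarter: "\<theta> (T / 4) = pi / 4" "\<alpha> (T / 4) = pi / 2"
  using symm(2)[of "T / 4"] symm(6)[of "T / 4"] by simp_all

lemma half: "r (T / 2) = pi / 2" "\<alpha> (T / 2) = pi"
  using symm(4)[of 0] symm(6)[of 0] init by simp_all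

lemma r_gt: "pi / 2 < r t" if "0 < t" "t < T / 2"
proof -
  have *: "pi / 2 < r s" if "0 < s" "s \<le> T / 4" for s
    using strict_mono_onD[OF mono(2), of 0 s] init that T_pos by simp
  show ?thesis using *[of t] *[of "T / 2 - t"] symm(4)[of t] that by (cases "t \<le> T / 4") auto
qed

lemma height_pos: "0 < height t" if "0 < t" "t < T / 2"
proof -
  have "cos (r t) < cos (pi / 2)" using r_gt[OF that] ranges(2)[of t] by (intro cos_monotone_0_pi) auto
  then show ?thesis by (simp add: height_def)
qed

lemma height_vals: "height 0 = 0" "height (T / 2) = 0" "height' 0 = 1" "height' (T / 4) = 0" "height' (T / 2) = - 1"
  unfolding height_def height'_def init half quarter by simp_all

lemma height_nonneg: "0 \<le> height t" if "0 \<le> t" "t \<le> T / 2"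
  using height_pos[of t] that height_vals by (cases "t = 0"; cases "t = T / 2") auto

lemma \<theta>_lt: "\<theta> t < pi / 4" if "- T / 4 < t" "t < T / 4"
proof -
  have *: "\<theta> s < pi / 4" if "0 \<le> s" "s < T / 4" for s
    using strict_mono_onD[OF mono(1), of s "T / 4"] quarter that T_pos by simp
  show ?thesis using *[of t] *[of "- t"] symm(1)[of t] that by (cases "0 \<le> t") auto
qed

definition diag :: "real \<Rightarrow> real" where "diag t = xc t - yc t"
definition diag' :: "real \<Rightarrow> real" where "diag' t = xc' t - yc' t"
definition diag'' :: "real \<Rightarrow> real" where
  "diag'' t = (- drift t * xc' t - lam * xc t + (real n - 1) * xc t / CS_E r \<theta> t)
     - (- drift t * yc' t - lam * yc t + (real n - 1) * yc t / CS_G r \<theta> t)"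

lemma diag_deriv: "(diag has_real_derivative diag' t) (at t)" "(diag' has_real_derivative diag'' t) (at t)"
  unfolding diag_def[abs_def] diag'_def[abs_def] diag''_def by (intro DERIV_diff xc_deriv yc_deriv)+

lemma diag_pos: "0 < diag t" if "- T / 4 < t" "t < T / 4"
proof -
  have "sin (\<theta> t) < sin (pi / 4)" "cos (pi / 4) < cos (\<theta> t)"
    using \<theta>_lt[OF that] ranges(1)[of t] by (auto intro!: sin_monotone_2pi cos_monotone_0_pi)
  then have "sin (\<theta> t) < cos (\<theta> t)" by (simp add: sin_45 cos_45)
  then show ?thesis using trig_pos(1)[of t] by (simp add: diag_def xc_def yc_def)
qed

text \<open>Strictness comes from n > 1 and survives at mu = lam, the case that z_1 requires;
  \<open>height\<close> is a strict supersolution only for mu < lam.\<close>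

lemma diag_super: "diag'' t + drift t * diag' t + mu * diag t < 0" if "- T / 4 < t" "t < T / 4" "mu \<le> lam"
proof -
  have xy: "0 < yc t" "yc t < xc t" using diag_pos[OF that(1,2)] trig_pos[of t] by (auto simp: diag_def yc_def)
  have "(real n - 1) * xc t / CS_E r \<theta> t = (real n - 1) * (1 / xc t)"
    "(real n - 1) * yc t / CS_G r \<theta> t = (real n - 1) * (1 / yc t)"
    using trig_pos[of t] by (simp_all add: xc_def yc_def CS_E_def CS_G_def power2_eq_square)
  then have "diag'' t + drift t * diag' t + lam * diag t = (real n - 1) * (1 / xc t - 1 / yc t)"
    unfolding diag''_def diag'_def diag_def by (simp only:) (simp add: algebra_simps)
  also have "\<dots> < 0" using xy n_gt by (intro mult_pos_neg) (auto simp: field_simps)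
  finally have "diag'' t + drift t * diag' t + lam * diag t < 0" .
  moreover have "mu * diag t \<le> lam * diag t"
    using diag_pos[OF that(1,2)] that(3) by (intro mult_right_mono) auto
  ultimately show ?thesis by linarith
qed

lemma diag_0: "diag' 0 = 0" "diag (T / 4) = 0" "diag (- T / 4) = 0"
proof -
  show "diag (T / 4) = 0" unfolding diag_def xc_def yc_def quarter by (simp add: sin_45 cos_45)
  have "\<theta> (- T / 4) = pi / 4" using quarter(1) symm(1)[of "T / 4"] by simp
  then show "diag (- T / 4) = 0" by (simp only: diag_def xc_def yc_def) (simp add: sin_45 cos_45)
qed (simp add: diag'_def xc'_def yc'_def init)

lemma diag_nonneg: "0 \<le> diag t" if "- T / 4 \<le> t" "t \<le> T / 4"
  using diag_pos[of t] diag_0 that by (cases "t = T / 4"; cases "t = - T / 4") auto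

end

section \<open>Spectrum of the hypersurface\<close>

text \<open>\<open>u\<close> is controlled on the unit sphere only, but the normalised curve stays
  there as long as |s| < 1 keeps the line away from the origin.\<close>

lemma sphere_lap_const:
  assumes u: "\<And>w. norm w = 1 \<Longrightarrow> u w = k" and y: "norm (y::real^'n) = 1"
  shows "sphere_lap u y = 0"
proof -
  have "deriv (deriv (\<lambda>s. u ((1 / norm (y + s *\<^sub>R axis i 1)) *\<^sub>R (y + s *\<^sub>R axis i 1)))) 0 = 0" (is "deriv (deriv ?f) 0 = 0") for i
  proof (rule deriv_deriv_eq[where f'="\<lambda>_. 0"])
    have const: "?f s = k" if "s \<in> {-1<..<1}" for s :: real
    proof (rule u)
      have "y + s *\<^sub>R axis i 1 \<noteq> 0"
      proof
        assume "y + s *\<^sub>R axis i 1 = 0"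
        then have "norm y = norm (s *\<^sub>R (axis i 1 :: real^'n))" by (metis add_eq_0_iff norm_minus_cancel)
        then show False using y that by (auto simp: norm_axis_1 abs_if split: if_splits)
      qed
      then show "norm ((1 / norm (y + s *\<^sub>R axis i 1)) *\<^sub>R (y + s *\<^sub>R axis i 1)) = 1" by simp
    qed
    have "(?f has_real_derivative 0) (at s)" if "s \<in> {-1<..<1}" for s :: real
      by (rule has_field_derivative_transform_within_open[OF DERIV_const[of k], where S="{-1<..<1}"]) (use that const in auto)
    then show "\<forall>\<^sub>F s in nhds 0. (?f has_real_derivative 0) (at s)"
      using eventually_nhds_in_open[of "{-1<..<1}" "0::real"] by (auto elim: eventually_mono)
  qed simp
  then show ?thesis by (simp add: sphere_lap_def)
qed

lemma CS_lap_eq_warped_lap: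
  fixes F :: "(real^'n) \<times> (real^'n) \<times> real \<Rightarrow> real"
  assumes C: "C2_on U F DF HF" and U: "(y, z, t) \<in> U" and y: "norm y = 1" and z: "norm z = 1"
  shows "CS_lap r \<theta> F (y, z, t) = warped_lap (\<lambda>t. (real CARD('n) - 1) / 2 * deriv (\<lambda>s. ln (CS_E r \<theta> s * CS_G r \<theta> s)) t)
    (CS_E r \<theta>) (CS_G r \<theta>) DF HF y z t"
proof -
  have "deriv (\<lambda>s. F (y, z, s)) t = DF (y, z, t) (0, 0, 1)"
    using C2_on_real(1)[OF C2_on_slices(3)[OF C, where y=y and z=z], of t] U by (auto intro: DERIV_imp_deriv)
  moreover have "deriv (deriv (\<lambda>s. F (y, z, s))) t = HF (y, z, t) (0, 0, 1) (0, 0, 1)"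
    using C2_on_real(2,3)[OF C2_on_slices(3)[OF C, where y=y and z=z], of t] U by (auto intro: deriv_deriv_eq)
  ultimately show ?thesis
    using sphere_lap_eq_form[OF C2_on_slices(1)[OF C, of z t], of y] sphere_lap_eq_form[OF C2_on_slices(2)[OF C, of y t], of z] U y z
    by (simp add: CS_lap_def warped_lap_def)
qed

text \<open>A partial derivative in direction b is again a constant times a function of t, namely c
  (snd (snd b)) f'. Carrying the factor \<open>c\<close> and a class \<open>P\<close> closed under
  differentiation makes the induction close.\<close>

lemma Ck_on_last_coordinate:
  assumes closed: "\<And>f. P f \<Longrightarrow> \<exists>f'. P f' \<and> (\<forall>t. (f has_real_derivative f' t) (at t))"
  shows "P f \<Longrightarrow> Ck_on k UNIV (\<lambda>p::'a::euclidean_space \<times> 'b::euclidean_space \<times> real. c * f (snd (snd p)))"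
proof (induction k arbitrary: c f)
  case 0
  obtain f' where "\<And>t. (f has_real_derivative f' t) (at t)" using closed[OF 0] by blast
  then have "continuous_on UNIV f" using DERIV_isCont by (blast intro: continuous_at_imp_continuous_on)
  then have "continuous_on UNIV (\<lambda>p::'a \<times> 'b \<times> real. f (snd (snd p)))"
    by (rule continuous_on_compose2) (auto intro!: continuous_intros)
  then show ?case by (auto intro!: continuous_intros)
next
  case (Suc k)
  obtain f' where f': "P f'" "\<And>t. (f has_real_derivative f' t) (at t)" using closed[OF Suc.prems] by blast
  have d: "((\<lambda>p::'a \<times> 'b \<times> real. c * f (snd (snd p))) has_derivative (\<lambda>h. c * (f' (snd (snd p)) * snd (snd h)))) (at p)" for p
  proof -
    have "((\<lambda>p::'a \<times> 'b \<times> real. snd (snd p)) has_derivative (\<lambda>h. snd (snd h))) (at p)"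
      by (intro bounded_linear_imp_has_derivative bounded_linear_compose[OF bounded_linear_snd bounded_linear_snd])
    from has_derivative_compose[OF this f'(2)[unfolded has_field_derivative_def]]
    show ?thesis by (rule has_derivative_mult_right)
  qed
  then have fd: "frechet_derivative (\<lambda>p::'a \<times> 'b \<times> real. c * f (snd (snd p))) (at p) b
      = (c * snd (snd b)) * f' (snd (snd p))" for p b
    using frechet_derivative_at[OF d[of p], symmetric] by simp
  have diff: "(\<lambda>p::'a \<times> 'b \<times> real. c * f (snd (snd p))) differentiable (at p)" for p
    using d unfolding differentiable_def by blast
  show ?case unfolding Ck_on.simps fd using diff Suc.IH[OF f'(1)] by blast
qed

lemma zero_near_imp_deriv_zero:
  fixes g :: "real \<Rightarrow> real"
  assumes "(g has_real_derivative D) (at c)" "a < c" "c < b" "\<And>t. a < t \<Longrightarrow> t < b \<Longrightarrow> g t = 0"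
  shows "D = 0"
proof -
  have "(g has_real_derivative 0) (at c)"
    by (rule has_field_derivative_transform_within_open[OF DERIV_const[where k="0::real"], where S="{a<..<b}"]) (use assms in auto)
  then show ?thesis using assms(1) DERIV_unique by blast
qed

context carlotto_schulz
begin

section \<open>Exclusion of periodic solutions and the sign of the derivative at T\<close>

lemma height_super: "(- drift t * height' t - lam * height t) + drift t * height' t + mu * height t < 0"
  if "0 < t" "t < T / 2" "mu < lam"
  using mult_strict_right_mono[OF that(3) height_pos[OF that(1,2)]] by simp

lemma periodic_solution_vanishes:
  assumes f: "solves drift mu f f'" and per: "\<And>t. f (t + T) = f t" and mu: "mu < lam" "mu \<noteq> 0"
  shows "f t = 0"
proof -
  have T2: "0 < T / 2" and T4: "- T / 4 < T / 4" using T_pos by simp_all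
  \<comment> \<open>The points -T/2 and T/2 differ by a period, so the odd part vanishes at T/2 as
    well as at 0.\<close>
  have half_shift: "f (- (T / 2)) = f (T / 2)" using per[of "- (T / 2)"] by simp
  define g where "g t = f t - f (- t)" for t
  define g' where "g' t = f' t + f' (- t)" for t
  have "solves drift mu (\<lambda>t. 1 * f t + - 1 * f (0 - t)) (\<lambda>t. 1 * f' t + - 1 * - f' (0 - t))"
    by (intro solves_linear_comb solves_reflect f) (simp add: drift_symm)
  then have g: "solves drift mu g g'" by (simp add: g_def[abs_def] g'_def[abs_def])
  have g0: "g t = 0" if "0 \<le> t" "t \<le> T / 2" for t
    by (rule comparison_vanishes[OF T2 weight g solvesD[OF solves_height] height_super _ _ _ that])
       (use mu height_nonneg half_shift in \<open>auto simp: g_def\<close>)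
  have even: "f (- t) = f t" if "- (T / 2) \<le> t" "t \<le> T / 2" for t
    using g0[of t] g0[of "- t"] that by (cases "0 \<le> t") (auto simp: g_def)
  have "g' 0 = 0"
    by (rule zero_near_imp_deriv_zero[OF solvesD(1)[OF g], of "- (T / 2)" _ "T / 2"])
       (use T2 even in \<open>auto simp: g_def\<close>)
  then have f'0: "f' 0 = 0" by (simp add: g'_def)
  define k where "k t = f t - f (T / 2 - t)" for t
  define k' where "k' t = f' t + f' (T / 2 - t)" for t
  have "solves drift mu (\<lambda>t. 1 * f t + - 1 * f (T / 2 - t)) (\<lambda>t. 1 * f' t + - 1 * - f' (T / 2 - t))"
    by (intro solves_linear_comb solves_reflect f) (simp add: drift_symm)
  then have k: "solves drift mu k k'" by (simp add: k_def[abs_def] k'_def[abs_def])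
  \<comment> \<open>The mirror image 3T/4 of -T/4 about T/4 differs from it by a period, so
    \<open>k\<close> vanishes at -T/4.\<close>
  have "T / 2 - - T / 4 = - T / 4 + T" by simp
  then have k_ends: "k (- T / 4) = 0" "k (T / 4) = 0"
    using per[of "- T / 4"] by (simp_all only: k_def) simp_all
  have k0: "k t = 0" if "- T / 4 \<le> t" "t \<le> T / 4" for t
    by (rule comparison_vanishes[OF T4 weight k diag_deriv diag_super _ _ _ that])
       (use mu diag_nonneg k_ends in auto)
  have k_all: "k t = 0" if "- T / 4 < t" "t < 3 * T / 4" for t
    using k0[of t] k0[of "T / 2 - t"] that by (cases "t \<le> T / 4") (auto simp: k_def)
  have "k' (T / 4) = 0"
    by (rule zero_near_imp_deriv_zero[OF solvesD(1)[OF k], of "- T / 4" _ "3 * T / 4"])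
       (use T_pos k_all in auto)
  then have f'4: "f' (T / 4) = 0" by (simp add: k'_def)

  \<comment> \<open>By the two symmetries \<open>f'\<close> vanishes at 0 and T/4. The mean value
    theorem applied to weight f' then gives an inner zero of mu f, hence of
    \<open>f\<close>.\<close>
  have "((\<lambda>t. weight t * f' t) has_real_derivative - mu * (weight t * f t)) (at t)" for t
    using DERIV_mult[OF weight(2) solvesD(2)[OF f], of t] by (simp add: algebra_simps)
  then obtain s where s: "0 < s" "s < T / 4"
    "weight (T / 4) * f' (T / 4) - weight 0 * f' 0 = (T / 4 - 0) * (- mu * (weight s * f s))"
    using MVT2[of 0 "T / 4" "\<lambda>t. weight t * f' t" "\<lambda>t. - mu * (weight t * f t)"] T_pos by auto
  then have fs: "f s = 0" using f'0 f'4 mu T_pos weight(1)[of s] by simp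
  \<comment> \<open>The Neumann end 0 is matched by a critical point of \<open>diag\<close>; on the
    other side of \<open>s\<close> the Neumann end T/4 is matched by one of
    \<open>height\<close>.\<close>
  have left: "f t = 0" if "0 \<le> t" "t \<le> s" for t
    by (rule comparison_vanishes[OF s(1) weight f diag_deriv diag_super _ _ _ that])
       (use mu diag_nonneg diag_0 fs f'0 s in auto)
  have right: "f t = 0" if "s \<le> t" "t \<le> T / 4" for t
    by (rule comparison_vanishes[OF s(2) weight f solvesD[OF solves_height] height_super _ _ _ that])
       (use mu height_nonneg height_vals fs f'4 s in auto)
  have f4: "f t = 0" if "0 \<le> t" "t \<le> T / 4" for t using left right that by (cases "t \<le> s") auto
  have f2: "f t = 0" if "0 \<le> t" "t \<le> T / 2" for t
    using f4[of t] f4[of "T / 2 - t"] k_all[of t] that T_pos by (cases "t \<le> T / 4") (auto simp: k_def)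
  have fT: "f t = 0" if "t \<in> {0..T}" for t
  proof (cases "t \<le> T / 2")
    case False
    then have "f (T - t) = 0" using that by (intro f2) auto
    moreover have "f (- (T - t)) = f (T - t)" using that False by (intro even) auto
    ultimately show ?thesis using per[of "t - T"] by simp
  qed (use that f2 in auto)
  obtain j :: int where "t + of_int j * T \<in> {0..T}" using periodic_shift[OF T_pos] .
  then show ?thesis using fT periodic_int[of f T t j, OF per] by metis
qed

text \<open>Reflection about T/4 gives z(T/2 - t) = z(T/2) z(t) - z'(T/2) height(t). With z(T/2) =
  -1 and \<open>z\<close> even, evaluating this at T/4 and its derivative at -T/2 yields z'(T)
  height(T/4) = 4 z(T/4).\<close>

lemma even_solution_derivative_pos:
  assumes z: "solves drift lam z z'" and init: "z 0 = 1" "z' 0 = 0"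
  shows "z' T > 0"
proof -
  \<comment> \<open>A zero s in (0, T/4] would allow a comparison with \<open>diag\<close> on
    [0, s], where z' and diag' both vanish at 0; \<open>z\<close> would then be zero at 0.\<close>
  have z4: "z (T / 4) > 0"
  proof (rule ccontr)
    assume "\<not> z (T / 4) > 0"
    moreover have "continuous_on {0..T / 4} z"
      using solvesD(1)[OF z] DERIV_isCont by (blast intro: continuous_at_imp_continuous_on)
    ultimately obtain s where s: "0 \<le> s" "s \<le> T / 4" "z s = 0"
      using IVT2'[of z "T / 4" 0 0] init T_pos by auto
    then have "0 < s" using init by (cases "s = 0") auto
    then have "z 0 = 0"
      by (rule comparison_vanishes[OF _ weight z diag_deriv diag_super])
         (use diag_nonneg diag_0 init s in auto)
    then show False using init by simp
  qed
  note space = solution_space[OF weight z init solves_height height_vals(1,3)]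
  have "solves drift lam (\<lambda>t. z (0 - t)) (\<lambda>t. - z' (0 - t))"
    by (rule solves_reflect[OF z]) (simp add: drift_symm)
  from space(2)[OF this, of "T / 2"] have odd: "z' (- (T / 2)) = - z' (T / 2)" using init by simp
  have "solves drift lam (\<lambda>t. z (T / 2 - t)) (\<lambda>t. - z' (T / 2 - t))"
    by (rule solves_reflect[OF z]) (simp add: drift_symm)
  note refl = space[OF this]
  \<comment> \<open>The Wronskian with \<open>height\<close> makes z(T/2) negative; applying the
    reflection at T/2 makes its square 1.\<close>
  have "weight (T / 2) * (z (T / 2) * height' (T / 2) - z' (T / 2) * height (T / 2)) = weight 0"
    using wronskian_constant[OF weight(2) z solves_height, of "T / 2"] init height_vals by simp
  then have "weight (T / 2) * - z (T / 2) > 0" using weight(1)[of 0] height_vals by simp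
  then have "z (T / 2) < 0" using weight(1)[of "T / 2"] by (simp add: mult_less_0_iff)
  moreover have "1 = z (T / 2) * z (T / 2)" using refl(1)[of "T / 2"] init height_vals by simp
  then have "z (T / 2) = 1 \<or> z (T / 2) = - 1" by (metis square_eq_1_iff)
  ultimately have z2: "z (T / 2) = - 1" by auto
  have "z' (T / 2) * height (T / 4) = - 2 * z (T / 4)"
    using refl(1)[of "T / 4"] z2 by simp
  then have "z' (T / 2) * height (T / 4) < 0" using z4 by simp
  then have neg: "z' (T / 2) < 0" using height_pos[of "T / 4"] T_pos by (simp add: mult_less_0_iff)
  have "height' (- (T / 2)) = - 1" unfolding height'_def symm half by simp
  then have "z' T = - 2 * z' (T / 2)" using refl(2)[of "- (T / 2)"] z2 odd by simp
  then show ?thesis using neg by simp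
qed

text \<open>A class of functions containing \<open>cos \<circ> r\<close> and closed under differentiation, from which
  smoothness follows.\<close>
inductive profile_algebra :: "(real \<Rightarrow> real) \<Rightarrow> bool" where
  "profile_algebra (\<lambda>t. k)"
| "profile_algebra (\<lambda>t. sin (r t))"
| "profile_algebra (\<lambda>t. cos (r t))"
| "profile_algebra (\<lambda>t. 1 / sin (r t))"
| "profile_algebra (\<lambda>t. sin (\<alpha> t))"
| "profile_algebra (\<lambda>t. cos (\<alpha> t))"
| "profile_algebra (\<lambda>t. sin (\<theta> t))"
| "profile_algebra (\<lambda>t. cos (\<theta> t))"
| "profile_algebra (\<lambda>t. 1 / sin (\<theta> t))"
| "profile_algebra (\<lambda>t. 1 / cos (\<theta> t))"
| "profile_algebra f \<Longrightarrow> profile_algebra g \<Longrightarrow> profile_algebra (\<lambda>t. f t + g t)"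
| "profile_algebra f \<Longrightarrow> profile_algebra g \<Longrightarrow> profile_algebra (\<lambda>t. f t * g t)"

lemma profile_algebra_uminus: "profile_algebra f \<Longrightarrow> profile_algebra (\<lambda>t. - f t)"
  using profile_algebra.intros(12)[OF profile_algebra.intros(1)[of "- 1"], of f] by simp

lemma profile_algebra_derivative:
  "profile_algebra f \<Longrightarrow> \<exists>f'. profile_algebra f' \<and> (\<forall>t. (f has_real_derivative f' t) (at t))"
proof (induction rule: profile_algebra.induct)
  note PI = profile_algebra.intros profile_algebra_uminus
  define A where "A t = ((real n - 1) * cos (\<alpha> t) * (cos (\<theta> t) * (1 / sin (\<theta> t)) + - (sin (\<theta> t) * (1 / cos (\<theta> t))))
      + - ((2 * real n - 1) * cos (r t) * sin (\<alpha> t))) * (1 / sin (r t))" for t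
  define B where "B t = sin (\<alpha> t) * (1 / sin (r t))" for t
  have PA: "profile_algebra A" and PB: "profile_algebra B"
    unfolding A_def[abs_def] B_def[abs_def] by (intro PI)+
  have dA: "(\<alpha> has_real_derivative A t) (at t)" for t using \<alpha>_deriv[of t] by (simp add: A_def cotd_def)
  have dB: "(\<theta> has_real_derivative B t) (at t)" for t using \<theta>_ode[of t] by (simp add: B_def)
  note derivs = r_ode dA dB
  note ne = trig_pos[THEN less_imp_neq, symmetric]
  {
    case (1 k)
    show ?case by (intro exI[of _ "\<lambda>_. 0"] conjI PI) auto
  next
    case 2
    show ?case by (intro exI[of _ "\<lambda>t. cos (r t) * cos (\<alpha> t)"] conjI PI)
        (auto intro!: derivative_eq_intros derivs)
  next
    case 3
    show ?case by (intro exI[of _ "\<lambda>t. - (sin (r t) * cos (\<alpha> t))"] conjI PI)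
        (auto intro!: derivative_eq_intros derivs)
  next
    case 4
    show ?case by (intro exI[of _ "\<lambda>t. - (cos (r t) * cos (\<alpha> t)) * ((1 / sin (r t)) * (1 / sin (r t)))"] conjI PI)
        (auto intro!: derivative_eq_intros derivs simp: ne)
  next
    case 5
    show ?case by (intro exI[of _ "\<lambda>t. cos (\<alpha> t) * A t"] conjI PI PA)
        (auto intro!: derivative_eq_intros derivs)
  next
    case 6
    show ?case by (intro exI[of _ "\<lambda>t. - (sin (\<alpha> t) * A t)"] conjI PI PA)
        (auto intro!: derivative_eq_intros derivs)
  next
    case 7
    show ?case by (intro exI[of _ "\<lambda>t. cos (\<theta> t) * B t"] conjI PI PB)
        (auto intro!: derivative_eq_intros derivs)
  next
    case 8
    show ?case by (intro exI[of _ "\<lambda>t. - (sin (\<theta> t) * B t)"] conjI PI PB)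
        (auto intro!: derivative_eq_intros derivs)
  next
    case 9
    show ?case by (intro exI[of _ "\<lambda>t. - (cos (\<theta> t) * B t) * ((1 / sin (\<theta> t)) * (1 / sin (\<theta> t)))"] conjI PI PB)
        (auto intro!: derivative_eq_intros derivs simp: ne)
  next
    case 10
    show ?case by (intro exI[of _ "\<lambda>t. (sin (\<theta> t) * B t) * ((1 / cos (\<theta> t)) * (1 / cos (\<theta> t)))"] conjI PI PB)
        (auto intro!: derivative_eq_intros derivs simp: ne)
  next
    case (11 f g)
    then obtain f' g' where *: "profile_algebra f'" "profile_algebra g'"
      "\<And>t. (f has_real_derivative f' t) (at t)" "\<And>t. (g has_real_derivative g' t) (at t)" by blast
    show ?case by (intro exI[of _ "\<lambda>t. f' t + g' t"] conjI PI * allI DERIV_add)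
  next
    case (12 f g)
    then obtain f' g' where *: "profile_algebra f'" "profile_algebra g'"
      "\<And>t. (f has_real_derivative f' t) (at t)" "\<And>t. (g has_real_derivative g' t) (at t)" by blast
    show ?case by (intro exI[of _ "\<lambda>t. f' t * g t + g' t * f t"] conjI PI * 12 allI DERIV_mult)
  }
qed

text \<open>The eigenfunction is cos r, the last coordinate of the embedding; it does not depend on
  the sphere factors, so only the equation for \<open>height\<close> is left.\<close>

lemma CS_eigenvalue_lam:
  assumes card: "n = CARD('n::finite)"
  shows "CS_eigenvalue r \<theta> T TYPE('n) lam"
proof -
  define F :: "(real^'n) \<times> (real^'n) \<times> real \<Rightarrow> real" where "F = (\<lambda>p. cos (r (snd (snd p))))"
  have F: "F (y, z, t) = - height t" for y z t by (simp add: F_def height_def)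
  have "Ck_on k UNIV (\<lambda>p::(real^'n) \<times> (real^'n) \<times> real. 1 * cos (r (snd (snd p))))" for k
    by (rule Ck_on_last_coordinate[of profile_algebra, OF profile_algebra_derivative profile_algebra.intros(3)])
  then have "smooth_on UNIV F" unfolding smooth_on_def F_def mult_1 by blast
  moreover have "F (y, z, t + T) = F (y, z, t)" for y z t by (simp add: F_def periodic)
  moreover have "\<exists>p\<in>CS_M. F p \<noteq> 0"
  proof
    fix i :: 'n
    show "(axis i 1, axis i 1, T / 4) \<in> (CS_M :: ((real^'n) \<times> (real^'n) \<times> real) set)" by (simp add: CS_M_def norm_axis_1)
    show "F (axis i 1, axis i 1, T / 4) \<noteq> 0" using height_pos[of "T / 4"] T_pos by (simp add: F)
  qed
  moreover have "- CS_lap r \<theta> F (y, z, t) = lam * F (y, z, t)" for y z t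
  proof -
    have d1: "((\<lambda>s. - height s) has_real_derivative - height' s) (at s)" for s
      by (intro DERIV_minus solvesD(1)[OF solves_height])
    have "deriv (\<lambda>s. - height s) t = - height' t" by (rule DERIV_imp_deriv[OF d1])
    moreover have "deriv (deriv (\<lambda>s. - height s)) t = - (- drift t * height' t - lam * height t)"
      by (rule deriv_deriv_eq[OF always_eventually DERIV_minus[OF solvesD(2)[OF solves_height]]]) (use d1 in blast)
    ultimately show ?thesis unfolding CS_lap_def card[symmetric] by (simp add: F sphere_lap_def drift_def)
  qed
  ultimately show ?thesis unfolding CS_eigenvalue_def
    by (intro exI[of _ F] exI[of _ UNIV]) auto
qed

lemma CS_eigenvalue_ge:
  assumes card: "n = CARD('n::finite)" and ev: "CS_eigenvalue r \<theta> T TYPE('n) mu" and nz: "mu \<noteq> 0"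
  shows "lam \<le> mu"
proof (rule ccontr)
  assume "\<not> lam \<le> mu"
  then have mu: "mu < lam" by simp
  obtain F :: "(real^'n) \<times> (real^'n) \<times> real \<Rightarrow> real" and U where
    U: "open U" "CS_M \<subseteq> U" "smooth_on U F"
    and F_per: "\<And>y z t. (y, z, t) \<in> CS_M \<Longrightarrow> F (y, z, t + T) = F (y, z, t)"
    and F_nz: "\<exists>p\<in>CS_M. F p \<noteq> 0" and eig: "\<And>p. p \<in> CS_M \<Longrightarrow> - CS_lap r \<theta> F p = mu * F p"
    using ev unfolding CS_eigenvalue_def by blast
  obtain DF HF where C: "C2_on U F DF HF" using smooth_on_imp_C2_on[OF U(3,1)] by blast
  have inM: "(y, z, t) \<in> (CS_M :: ((real^'n) \<times> (real^'n) \<times> real) set)" if "norm y = 1" "norm z = 1" for y z t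
    using that by (simp add: CS_M_def)
  have W: "warped_lap drift (CS_E r \<theta>) (CS_G r \<theta>) DF HF y z t = - mu * F (y, z, t)" if "norm y = 1" "norm z = 1" for y z t
  proof -
    have "CS_lap r \<theta> F (y, z, t) = warped_lap drift (CS_E r \<theta>) (CS_G r \<theta>) DF HF y z t"
      unfolding drift_def[abs_def] unfolding card
      by (rule CS_lap_eq_warped_lap[OF C _ that]) (use U(2) inM[OF that] in blast)
    then show ?thesis using eig[OF inM[OF that, of t]] by simp
  qed
  have per: "CS_E r \<theta> (t + T) = CS_E r \<theta> t" "CS_G r \<theta> (t + T) = CS_G r \<theta> t" "xc (t + T) = xc t" "yc (t + T) = yc t" for t
    by (simp_all add: CS_E_def CS_G_def xc_def yc_def periodic)
  have pos: "0 < xc t" "0 < yc t" for t using trig_pos[of t] by (simp_all add: xc_def yc_def)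
  have "continuous_on UNIV r" "continuous_on UNIV \<theta>"
    using r_ode \<theta>_ode DERIV_isCont by (blast intro: continuous_at_imp_continuous_on)+
  then have cont: "continuous_on UNIV (CS_E r \<theta>)" "continuous_on UNIV (CS_G r \<theta>)"
    unfolding CS_E_def[abs_def] CS_G_def[abs_def] by (auto intro!: continuous_intros)
  have xd: "(xc' has_real_derivative - drift t * xc' t - lam * xc t + (real CARD('n) - 1) * xc t / CS_E r \<theta> t) (at t)" for t
    unfolding card[symmetric] by (rule xc_deriv(2))
  have y_inv: "F (y1, z, t) \<le> F (y2, z, t)" if "norm y1 = 1" "norm y2 = 1" "norm z = 1" for y1 y2 z t
    by (rule warped_lap_rotation_invariant_le[OF C U(2) T_pos _ per(1,3) EG_pos pos(1) cont(1)
          xc_deriv(1) xd W mu that])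
       (use F_per inM in auto)
  have yd: "(yc' has_real_derivative - drift t * yc' t - lam * yc t + (real CARD('n) - 1) * yc t / CS_G r \<theta> t) (at t)" for t
    unfolding card[symmetric] by (rule yc_deriv(2))
  \<comment> \<open>Exchanging the two spheres reduces invariance in the second one to the lemma
    already used, with \<open>E\<close>, \<open>xc\<close> replaced by \<open>G\<close>,
    \<open>yc\<close>.\<close>
  define \<sigma> where "\<sigma> = (\<lambda>p::(real^'n) \<times> (real^'n) \<times> real. (fst (snd p), fst p, snd (snd p)))"
  have "bounded_linear \<sigma>" unfolding \<sigma>_def
    by (intro bounded_linear_Pair bounded_linear_fst bounded_linear_compose[OF bounded_linear_fst bounded_linear_snd]
        bounded_linear_compose[OF bounded_linear_snd bounded_linear_snd])
  note C' = C2_on_compose_affine[OF C this, of 0, simplified]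
  have z_inv: "F (y, z1, t) \<le> F (y, z2, t)" if "norm z1 = 1" "norm z2 = 1" "norm y = 1" for z1 z2 y t
  proof -
    have "CS_M \<subseteq> {w. \<sigma> w \<in> U}" using U(2) by (auto simp: CS_M_def \<sigma>_def)
    moreover have "warped_lap drift (CS_G r \<theta>) (CS_E r \<theta>) (\<lambda>w d. DF (\<sigma> w) (\<sigma> d)) (\<lambda>w d c. HF (\<sigma> w) (\<sigma> d) (\<sigma> c)) y z t
        = - mu * F (\<sigma> (y, z, t))" if "norm y = 1" "norm z = 1" for y z t
      using W[OF that(2,1), of t] by (simp add: warped_lap_def \<sigma>_def)
    ultimately have "F (\<sigma> (z1, y, t)) \<le> F (\<sigma> (z2, y, t))"
      by (intro warped_lap_rotation_invariant_le[OF C' _ T_pos _ per(2,4) EG_pos(2,1) pos(2) cont(2)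
            yc_deriv(1) yd _ mu that])
         (use F_per inM in \<open>auto simp: \<sigma>_def\<close>)
    then show ?thesis by (simp add: \<sigma>_def)
  qed
  define e where "e = (axis undefined 1 :: real^'n)"
  have e: "norm e = 1" by (simp add: e_def norm_axis_1)
  have F_eq: "F (y, z, t) = F (e, e, t)" if "norm y = 1" "norm z = 1" for y z t
    using y_inv[OF that(1) e that(2), of t] y_inv[OF e that, of t] z_inv[OF that(2) e e, of t] z_inv[OF e that(2) e, of t] by linarith
  define f where "f t = F (e, e, t)" for t
  define f' where "f' t = DF (e, e, t) (0, 0, 1)" for t
  have inU: "(e, e, t) \<in> U" for t using inM[OF e e] U(2) by blast
  have "solves drift mu f f'"
    unfolding solves_def
  proof (intro allI conjI)
    fix t
    note R = C2_on_real[OF C2_on_slices(3)[OF C, where y=e and z=e], of t]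
    show "(f has_real_derivative f' t) (at t)" using R(1) inU by (simp add: f_def[abs_def] f'_def)
    \<comment> \<open>\<open>F\<close> is constant on the spheres only, so its ambient gradient and
      Hessian need not vanish; their combination does, being the spherical Laplacian.\<close>
    have "sphere_lap (\<lambda>w. F (w, e, t)) e = 0" "sphere_lap (\<lambda>w. F (e, w, t)) e = 0"
      using F_eq e by (auto intro!: sphere_lap_const[where k="F (e, e, t)"])
    then have "HF (e, e, t) (0, 0, 1) (0, 0, 1) + drift t * f' t = - mu * f t"
      using W[OF e e, of t] sphere_lap_eq_form[OF C2_on_slices(1)[OF C, of e t], of e]
        sphere_lap_eq_form[OF C2_on_slices(2)[OF C, of e t], of e] inU e
      by (simp add: warped_lap_def f_def f'_def)
    then have "HF (e, e, t) (0, 0, 1) (0, 0, 1) = - drift t * f' t - mu * f t" by simp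
    then show "(f' has_real_derivative - drift t * f' t - mu * f t) (at t)"
      using R(2) inU by (simp add: f'_def[abs_def])
  qed
  moreover have "f (t + T) = f t" for t unfolding f_def by (rule F_per[OF inM[OF e e]])
  ultimately have "f t = 0" for t using mu nz by (rule periodic_solution_vanishes)
  then show False using F_nz F_eq by (auto simp: CS_M_def f_def)
qed

lemma first_nonzero_eigenvalue_eq_lam:
  assumes card: "n = CARD('n::finite)"
  shows "first_nonzero_eigenvalue r \<theta> T TYPE('n) = lam"
  unfolding first_nonzero_eigenvalue_def
proof (rule cInf_eq_minimum)
  have "lam \<noteq> 0" using n_gt by (simp add: lam_def)
  then show "lam \<in> {mu. mu \<noteq> 0 \<and> CS_eigenvalue r \<theta> T TYPE('n) mu}" using CS_eigenvalue_lam[OF card] by simp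
qed (use CS_eigenvalue_ge[OF card] in blast)

end

theorem mainTheorem2:
  fixes r \<theta> \<alpha> z1 z1' :: "real \<Rightarrow> real" and T r0 \<theta>0 :: real
  defines "n \<equiv> CARD('n::finite)"
  assumes n_gt: "n > 1"
    and r_ode: "\<And>t. (r has_real_derivative cos (\<alpha> t)) (at t)"
    and \<theta>_ode: "\<And>t. (\<theta> has_real_derivative sin (\<alpha> t) / sin (r t)) (at t)"
    and \<alpha>_ode: "\<And>t. (\<alpha> has_real_derivative
            (2 * real n - 2) / sin (r t) * cos (\<alpha> t) * cot (2 * \<theta> t)
          - (2 * real n - 1) * cot (r t) * sin (\<alpha> t)) (at t)"
    and T_pos: "T > 0" and r0: "0 < r0" "r0 < pi / 2" and \<theta>0: "0 < \<theta>0" "\<theta>0 < pi / 4"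
    and init: "r 0 = pi / 2" "\<alpha> 0 = 0" "\<theta> 0 = \<theta>0"
    and quarter: "\<theta> (- T / 4) = pi / 4" "r (- T / 4) = r0" "\<alpha> (- T / 4) = - pi / 2"
    and periodic: "\<And>t. r (t + T) = r t" "\<And>t. \<theta> (t + T) = \<theta> t" "\<And>t. \<alpha> (t + T) = \<alpha> t + 2 * pi"
    and symm: "\<And>t. \<theta> (- t) = \<theta> t" "\<And>t. \<theta> (T / 2 - t) = pi / 2 - \<theta> t"
              "\<And>t. r (- t) = pi - r t" "\<And>t. r (T / 2 - t) = r t"
              "\<And>t. \<alpha> (- t) = - \<alpha> t" "\<And>t. \<alpha> (T / 2 - t) = pi - \<alpha> t"
    and mono: "strict_mono_on {0..T / 2} \<theta>" "strict_mono_on {- T / 4..T / 4} r" "strict_mono \<alpha>"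
    and ranges: "\<And>t. 0 < \<theta> t \<and> \<theta> t < pi / 2" "\<And>t. 0 < r t \<and> r t < pi"
    and z1_d1: "\<And>t. (z1 has_real_derivative z1' t) (at t)"
    and z1_d2: "\<And>t. (z1' has_real_derivative
            - ((real n - 1) / 2 * deriv (\<lambda>s. ln (CS_E r \<theta> s * CS_G r \<theta> s)) t * z1' t)
            - (2 * real n - 1) * z1 t) (at t)"
    and z1_init: "z1 0 = 1" "z1' 0 = 0"
  shows "first_nonzero_eigenvalue r \<theta> T TYPE('n) = 2 * real n - 1 \<longleftrightarrow> z1' T > 0"
proof -
  have card: "n = CARD('n)" by (simp add: n_def)
  interpret carlotto_schulz r \<theta> \<alpha> T n
    by unfold_locales (fact assms)+
  have "solves drift lam z1 z1'"
    unfolding solves_def using z1_d1 z1_d2 by (simp add: drift_def lam_def)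
  then have "z1' T > 0" using even_solution_derivative_pos z1_init by blast
  moreover have "first_nonzero_eigenvalue r \<theta> T TYPE('n) = 2 * real n - 1"
    using first_nonzero_eigenvalue_eq_lam[OF card] unfolding lam_def .
  ultimately show ?thesis by simp
qed

end
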